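(* Let $n$ be a positive integer. Then $$t(1,1,2,16;n)=4\sum_{d\mid 2n+5}\frac{2n+5}{d}\left(\frac 2d\right)-4\sum_{\substack{(r,s)\in\mathbb Z^2,\ 4\mid r-1\\ 2n+5=r^2+2s^2}} r,$$ where the first sum is over positive divisors $d$.
   Context: $\left(\frac{a}{m}\right)$ is the Legendre–Jacobi–Kronecker symbol. For positive integers $a,b,c,d$ and a nonnegative integer $n$, $t(a,b,c,d;n)$ denotes the number of $(x,y,z,w)\in\mathbb Z^4$ with $n=a\frac{x(x-1)}2+b\frac{y(y-1)}2+c\frac{z(z-1)}2+d\frac{w(w-1)}2$. *)

theory Defs
  imports "HOL-Number_Theory.Number_Theory"
begin

definition kronecker_prime :: "int \<Rightarrow> int \<Rightarrow> int" where
  "kronecker_prime a p =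
     (if p = 2 then (if even a then 0 else if a mod 8 = 1 \<or> a mod 8 = 7 then 1 else -1)
      else Legendre a p)"

text \<open>The Legendre--Jacobi--Kronecker symbol, for arbitrary integers. The sign factor is
  the value of the symbol at the unit part of \<open>m\<close>; on integers, \<open>prime_factors m\<close> consists of
  positive primes only.\<close>

definition kronecker :: "int \<Rightarrow> int \<Rightarrow> int" where
  "kronecker a m =
     (if m = 0 then (if \<bar>a\<bar> = 1 then 1 else 0)
      else (if m < 0 \<and> a < 0 then -1 else 1) *
           (\<Prod>p\<in>prime_factors m. kronecker_prime a p ^ multiplicity p m))"

text \<open>The division by 2 is exact. The set is finite when \<open>a\<close>, \<open>b\<close>, \<open>c\<close>, \<open>d\<close> are all positive.\<close>

definition t :: "nat \<Rightarrow> nat \<Rightarrow> nat \<Rightarrow> nat \<Rightarrow> nat \<Rightarrow> nat" where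
  "t a b c d n = card {(x :: int, y :: int, z :: int, w :: int).
     int n = int a * (x * (x - 1) div 2) + int b * (y * (y - 1) div 2)
           + int c * (z * (z - 1) div 2) + int d * (w * (w - 1) div 2)}"

end

theory Submission
  imports Defs
begin

text \<open>
  Put \<open>m = 2n + 5\<close>. Completing squares and rotating pairs of variables turns \<open>t(1,1,2,16;n)\<close> into
  four times the number of solutions of \<open>m = c\<^sup>2 + 2e\<^sup>2 + 4f\<^sup>2 + 4w\<^sup>2\<close> with \<open>w\<close> odd, and that number is
  \<open>(A - B) / 2\<close>, where \<open>A\<close> counts all solutions and \<open>B\<close> is the sum of \<open>(-1)\<^bsup>u+v\<^esup>\<close> over
  \<open>m = c\<^sup>2 + 2e\<^sup>2 + 8u\<^sup>2 + 8v\<^sup>2\<close>.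

  The classical divisor sums for \<open>x\<^sup>2 + y\<^sup>2\<close> and \<open>x\<^sup>2 + 2y\<^sup>2\<close> turn \<open>A\<close> into a sum of
  \<open>\<chi>\<^sub>-\<^sub>4(x) \<chi>\<^sub>-\<^sub>8(y)\<close> over \<open>a x + b y = 4m\<close> with all variables odd. The terms with \<open>x = y\<close> give twice the
  divisor sum of the theorem. After symmetrizing, only \<open>x \<equiv> \<plusminus>y (mod 8)\<close> contributes, and the
  contributions of \<open>x \<equiv> y\<close>, \<open>x \<noteq> y\<close> and of \<open>x \<equiv> -y\<close> cancel by a bijection of Liouville type.

  For \<open>B\<close>, the sum of \<open>(-1)\<^bsup>u+v\<^esup>\<close> over \<open>M = c\<^sup>2 + 8u\<^sup>2 + 8v\<^sup>2\<close> is \<open>2r\<close> if \<open>M = r\<^sup>2\<close> with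
  \<open>r \<equiv> 1 (mod 4)\<close>, and \<open>0\<close> if \<open>M\<close> is not a square; this is Jacobi's series for
  \<open>\<Prod>(1 - q\<^sup>k)\<^sup>3\<close> in disguise. By the two-square theorem it is a statement about
  \<open>M = c\<^sup>2 + 4de\<close>. The substitution \<open>y = c + 2d\<close>, \<open>h = e - c - d\<close> makes the weight depend on \<open>y\<close> and
  \<open>h\<close> only; for fixed \<open>\<bar>h\<bar>\<close> the values \<open>y\<close> fill a complete residue system modulo \<open>4h\<close>, or intervals
  that are symmetric about \<open>0\<close> and \<open>2h\<close>, on which the odd character \<open>\<chi>\<^sub>-\<^sub>4\<close> sums to zero up to a
  boundary term for square \<open>M\<close>.
\<close>


section \<open>Quadratic characters modulo 4 and 8\<close>

definition chi4 :: "int \<Rightarrow> int" where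
  "chi4 d = (if d mod 4 = 1 then 1 else if d mod 4 = 3 then -1 else 0)"

text \<open>As Kronecker symbols, \<open>chi4\<close> has discriminant -4 and \<open>chi8\<close>
  has discriminant 8; the product \<open>chi4 d * chi8 d\<close> is the symbol of discriminant
  -8.\<close>

definition chi8 :: "int \<Rightarrow> int" where
  "chi8 d = (if d mod 8 = 1 \<or> d mod 8 = 7 then 1 else if d mod 8 = 3 \<or> d mod 8 = 5 then -1 else 0)"

lemma chi4_mod: "chi4 (d mod 4) = chi4 d"
  by (simp add: chi4_def)

lemma chi8_mod: "chi8 (d mod 8) = chi8 d"
  by (simp add: chi8_def)

lemma chi4_mult: "chi4 (a * b) = chi4 a * chi4 b"
proof -
  have "chi4 (r * s) = chi4 r * chi4 s" if "r \<in> {0, 1, 2, 3}" "s \<in> {0, 1, 2, 3}" for r s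
    using that by (elim insertE emptyE) (simp_all add: chi4_def)
  moreover have "a mod 4 \<in> {0, 1, 2, 3}" "b mod 4 \<in> {0, 1, 2, 3}"
    by (simp_all, presburger+)
  ultimately have "chi4 ((a mod 4) * (b mod 4)) = chi4 a * chi4 b"
    by (simp only: chi4_mod)
  thus ?thesis
    unfolding chi4_def mod_mult_eq .
qed

lemma chi8_mult: "chi8 (a * b) = chi8 a * chi8 b"
proof -
  have "chi8 (r * s) = chi8 r * chi8 s"
    if "r \<in> {0, 1, 2, 3, 4, 5, 6, 7}" "s \<in> {0, 1, 2, 3, 4, 5, 6, 7}" for r s
    using that by (elim insertE emptyE) (simp_all add: chi8_def)
  moreover have "a mod 8 \<in> {0, 1, 2, 3, 4, 5, 6, 7}" "b mod 8 \<in> {0, 1, 2, 3, 4, 5, 6, 7}"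
    by (simp_all, presburger+)
  ultimately have "chi8 ((a mod 8) * (b mod 8)) = chi8 a * chi8 b"
    by (simp only: chi8_mod)
  thus ?thesis
    unfolding chi8_def mod_mult_eq .
qed

lemma chi4_odd: "odd d \<Longrightarrow> chi4 d = 1 \<or> chi4 d = -1"
  unfolding chi4_def by presburger

lemma chi8_odd: "odd d \<Longrightarrow> chi8 d = 1 \<or> chi8 d = -1"
  unfolding chi8_def by presburger

lemma chi4_even: "even d \<Longrightarrow> chi4 d = 0"
  unfolding chi4_def by presburger

lemma chi4_uminus: "chi4 (- d) = - chi4 d"
  unfolding chi4_def by presburger

lemma chi4_add_4: "chi4 (d + 4 * k) = chi4 d"
  unfolding chi4_def by simp

lemma chi8_add_8: "chi8 (d + 8 * k) = chi8 d"
  unfolding chi8_def by simp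

section \<open>Legendre symbols of 2, -1 and -2\<close>

lemma Legendre_2:
  assumes "prime p" "odd p"
  shows "Legendre 2 (int p) = chi8 (int p)"
proof -
  have p2: "2 < p"
    using assms by (metis nat_less_le prime_ge_2_nat even_numeral)
  interpret GAUSS p 2
  proof
    show "[2 \<noteq> 0] (mod int p)"
      using p2 by (simp add: cong_def)
  qed (use assms p2 in auto)
  define h where "h = (int p - 1) div 2"
  have ph: "int p = 2 * h + 1" and h0: "h > 0"
    using assms p2 unfolding h_def by presburger+
  \<comment> \<open>Gauss's lemma counts the residues of 2, 4, ..., 2h that exceed h. All of these
    lie below p = 2h + 1, so no reduction takes place, and those exceeding h are the doubles of h
    div 2 + 1, ..., h.\<close>
  have "C = (\<lambda>x. 2 * x) ` {0<..h}"
    unfolding C_def B_def A_def image_image h_def [symmetric]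
    by (rule image_cong) (auto simp: ph)
  hence "E = (\<lambda>x. 2 * x) ` {h div 2<..h}"
    unfolding E_def h_def [symmetric] by (auto simp: image_iff)
  hence "card E = nat (h - h div 2)"
    by (simp add: card_image inj_on_def)
  hence "Legendre 2 (int p) = (-1) ^ nat (h - h div 2)"
    using gauss_lemma by simp
  also have "\<dots> = (if even (h - h div 2) then 1 else -1)"
    using h0 by (auto simp: even_nat_iff)
  also have "\<dots> = chi8 (int p)"
    unfolding chi8_def ph by (auto; presburger)
  finally show ?thesis .
qed

text \<open>Euler's criterion determines the symbol modulo p. It lies in {-1, 0, 1}, so it differs
  from e by at most 2 < p, and congruence becomes equality.\<close>

lemma Legendre_eqI:
  assumes p: "prime p" "2 < p" and e: "e = 1 \<or> e = -1"
    and "[a ^ ((p - 1) div 2) = e] (mod int p)"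
  shows "Legendre a (int p) = e"
proof -
  have "[Legendre a (int p) = e] (mod int p)"
    using euler_criterion [OF p, of a] assms(4) cong_trans by blast
  hence dv: "int p dvd Legendre a (int p) - e"
    by (simp add: cong_iff_dvd_diff)
  have "Legendre a (int p) \<in> {-1, 0, 1}"
    by (auto simp: Legendre_def)
  hence "\<bar>Legendre a (int p) - e\<bar> < int p"
    using e p(2) by auto
  with dv have "Legendre a (int p) - e = 0"
    using dvd_imp_le_int [of "Legendre a (int p) - e" "int p"] by linarith
  thus ?thesis
    by simp
qed

lemma minus_one_power_half_eq_chi4:
  assumes "odd p"
  shows "(-1 :: int) ^ ((p - 1) div 2) = chi4 (int p)"
proof -
  have "(-1 :: int) ^ ((p - 1) div 2) = (if even ((p - 1) div 2) then 1 else -1)"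
    by simp
  also have "even ((p - 1) div 2) \<longleftrightarrow> int p mod 4 = 1"
    using assms by presburger
  finally show ?thesis
    unfolding chi4_def using assms by (auto; presburger)
qed

lemma Legendre_minus_1:
  assumes "prime p" "odd p"
  shows "Legendre (-1) (int p) = chi4 (int p)"
proof (rule Legendre_eqI)
  show "2 < p"
    using assms by (metis nat_less_le prime_ge_2_nat even_numeral)
  show "[(-1) ^ ((p - 1) div 2) = chi4 (int p)] (mod int p)"
    using minus_one_power_half_eq_chi4 assms by simp
qed (use assms chi4_odd in auto)

lemma Legendre_minus_2:
  assumes "prime p" "odd p"
  shows "Legendre (-2) (int p) = chi4 (int p) * chi8 (int p)"
proof (rule Legendre_eqI)
  show p2: "2 < p"
    using assms by (metis nat_less_le prime_ge_2_nat even_numeral)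
  have "[2 ^ ((p - 1) div 2) = chi8 (int p)] (mod int p)"
    using euler_criterion [OF assms(1) p2, of 2] Legendre_2 [OF assms] cong_sym by simp
  hence "[(-1) ^ ((p - 1) div 2) * 2 ^ ((p - 1) div 2) = chi4 (int p) * chi8 (int p)] (mod int p)"
    using minus_one_power_half_eq_chi4 [OF assms(2)] by (metis cong_scalar_left)
  thus "[(-2) ^ ((p - 1) div 2) = chi4 (int p) * chi8 (int p)] (mod int p)"
    by (metis mult_minus1 power_mult_distrib)
qed (use assms chi4_odd [of "int p"] chi8_odd [of "int p"] in auto)

text \<open>By definition the symbol is a product over prime powers, and \<open>chi8\<close> is
  completely multiplicative, so agreement at the odd primes is enough.\<close>

lemma kronecker_2_eq_chi8:
  assumes "odd m" "m > 0"
  shows "kronecker 2 m = chi8 m"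
proof -
  have eq: "kronecker_prime 2 p = chi8 p" if "p \<in> prime_factors m" for p
  proof -
    have p: "prime p" "p dvd m"
      using that by auto
    have "odd p" "p > 0"
      using p assms dvd_trans prime_gt_0_int by auto
    with p have "prime (nat p)" "odd (nat p)" "int (nat p) = p"
      by (auto simp: even_nat_iff)
    with Legendre_2 [of "nat p"] \<open>odd p\<close> show ?thesis
      by (auto simp: kronecker_prime_def)
  qed
  have prod: "chi8 (\<Prod>p\<in>A. p ^ f p) = (\<Prod>p\<in>A. chi8 p ^ f p)" if "finite A" for A and f :: "int \<Rightarrow> nat"
  proof -
    have pow: "chi8 (p ^ k) = chi8 p ^ k" for p k
      by (induction k) (simp_all add: chi8_mult, simp add: chi8_def)
    have "chi8 1 = 1"
      by (simp add: chi8_def)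
    with that show ?thesis
      by (induction A rule: finite_induct) (simp_all add: chi8_mult pow)
  qed
  have "kronecker 2 m = (\<Prod>p\<in>prime_factors m. chi8 p ^ multiplicity p m)"
    using assms eq by (simp add: kronecker_def)
  also have "\<dots> = chi8 (\<Prod>p\<in>prime_factors m. p ^ multiplicity p m)"
    by (simp add: prod)
  also have "\<dots> = chi8 m"
    using assms by (subst prod_prime_factors) auto
  finally show ?thesis .
qed

section \<open>The binary forms \<open>x\<^sup>2 + y\<^sup>2\<close> and \<open>x\<^sup>2 + 2y\<^sup>2\<close>\<close>

lemma int_sqrt_exists:
  fixes M :: int
  assumes "0 \<le> M"
  shows "\<exists>s. 0 \<le> s \<and> s\<^sup>2 \<le> M \<and> M < (s + 1)\<^sup>2"
  using assms
proof (induction M rule: int_ge_induct)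
  case base
  show ?case by (intro exI [of _ 0]) auto
next
  case (step M)
  then obtain s where s: "0 \<le> s" "s\<^sup>2 \<le> M" "M < (s + 1)\<^sup>2" by blast
  show ?case
  proof (cases "M + 1 < (s + 1)\<^sup>2")
    case True
    with s show ?thesis by (intro exI [of _ s]) auto
  next
    case False
    with s have "M + 1 = (s + 1)\<^sup>2" by simp
    thus ?thesis
      using s(1) by (intro exI [of _ "s + 1"]) (auto simp: power2_eq_square algebra_simps)
  qed
qed

text \<open>Pigeonhole: with k the integer square root of p, there are (k + 1)^2 > p pairs in
  [0, k]^2 but only p residues of x - r y. The difference of two colliding pairs works; the bounds
  are strict because a prime is not a square.\<close>

lemma Thue_lemma:
  fixes p r :: int
  assumes "prime p"
  shows "\<exists>x y. (x, y) \<noteq> (0, 0) \<and> x\<^sup>2 < p \<and> y\<^sup>2 < p \<and> p dvd x - r * y"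
proof -
  have p0: "p > 0"
    using assms prime_gt_0_int by blast
  obtain k where k: "0 \<le> k" "k\<^sup>2 \<le> p" "p < (k + 1)\<^sup>2"
    using int_sqrt_exists [of p] p0 by auto
  have small: "x\<^sup>2 < p" if "\<bar>x\<bar> \<le> k" for x
  proof -
    have "x\<^sup>2 \<le> k\<^sup>2"
      using that k(1) by (metis abs_le_square_iff abs_of_nonneg)
    also have "\<dots> \<le> p"
      by (rule k(2))
    finally have "x\<^sup>2 \<le> p" .
    moreover have "x\<^sup>2 \<noteq> p"
    proof
      assume "x\<^sup>2 = p"
      with assms have "prime (x ^ 2)" by simp
      thus False by (simp add: prime_power_iff)
    qed
    ultimately show ?thesis by simp
  qed
  define f where "f = (\<lambda>(x, y). (x - r * y) mod p)"
  let ?A = "{0..k} \<times> {0..k}"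
  have "int (card ?A) = (k + 1)\<^sup>2"
    using k(1) by (simp add: card_cartesian_product power2_eq_square)
  moreover have "f ` ?A \<subseteq> {0..<p}"
    using p0 by (auto simp: f_def)
  hence "card (f ` ?A) \<le> nat p"
    by (metis card_atLeastLessThan_int card_mono diff_zero finite_atLeastLessThan_int)
  ultimately have "\<not> inj_on f ?A"
    using k(3) p0 by (intro pigeonhole) linarith
  then obtain x1 y1 x2 y2 where *: "(x1, y1) \<in> ?A" "(x2, y2) \<in> ?A" "(x1, y1) \<noteq> (x2, y2)"
    "(x1 - r * y1) mod p = (x2 - r * y2) mod p"
    unfolding inj_on_def f_def by fastforce
  have "p dvd (x1 - r * y1) - (x2 - r * y2)"
    using *(4) mod_eq_dvd_iff by blast
  also have "(x1 - r * y1) - (x2 - r * y2) = (x1 - x2) - r * (y1 - y2)"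
    by (simp add: algebra_simps)
  finally have "p dvd (x1 - x2) - r * (y1 - y2)" .
  moreover have "(x1 - x2)\<^sup>2 < p" "(y1 - y2)\<^sup>2 < p"
    using *(1,2) by (auto intro!: small)
  ultimately show ?thesis
    using *(3) by (intro exI [of _ "x1 - x2"] exI [of _ "y1 - y2"]) auto
qed

text \<open>For r^2 = -D modulo p, Thue's lemma gives x^2 + D y^2 = p k with 0 < k < 1 + D. Hence k
  = 1, or k = D = 2.\<close>

lemma prime_is_form:
  fixes p D :: int
  assumes "prime p" "D = 1 \<or> D = 2" "QuadRes p (- D)"
  shows "\<exists>u v. p = u\<^sup>2 + D * v\<^sup>2"
proof -
  obtain r where "[r\<^sup>2 = - D] (mod p)"
    using assms(3) by (auto simp: QuadRes_def)
  hence r: "p dvd r\<^sup>2 + D"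
    by (simp add: cong_iff_dvd_diff)
  obtain x y where xy: "(x, y) \<noteq> (0, 0)" "x\<^sup>2 < p" "y\<^sup>2 < p" "p dvd x - r * y"
    using Thue_lemma [OF assms(1)] by blast
  have "x\<^sup>2 + D * y\<^sup>2 = (x - r * y) * (x + r * y) + (r\<^sup>2 + D) * y\<^sup>2"
    by (simp add: algebra_simps power2_eq_square)
  hence "p dvd x\<^sup>2 + D * y\<^sup>2"
    using r xy(4) by simp
  then obtain k where k: "x\<^sup>2 + D * y\<^sup>2 = p * k"
    by (auto elim: dvdE)
  have p0: "p > 0"
    using assms(1) prime_gt_0_int by blast
  have "x\<^sup>2 > 0 \<or> y\<^sup>2 > 0" "x\<^sup>2 \<ge> 0" "y\<^sup>2 \<ge> 0"
    using xy(1) by auto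
  moreover have "p * k = x\<^sup>2 + y\<^sup>2 \<or> p * k = x\<^sup>2 + 2 * y\<^sup>2"
    using k assms(2) by auto
  ultimately have "p * k > 0"
    by linarith
  hence "k > 0"
    using p0 by (simp add: zero_less_mult_iff)
  moreover have "p * k < p * (1 + D)"
    using k [symmetric] assms(2) xy(2,3) by (auto simp: algebra_simps)
  hence "k < 1 + D"
    using p0 by simp
  ultimately have "k = 1 \<or> (k = 2 \<and> D = 2)"
    using assms(2) by auto
  thus ?thesis
  proof
    assume "k = 1"
    with k show ?thesis by (metis mult.right_neutral)
  next
    assume "k = 2 \<and> D = 2"
    hence eq: "x\<^sup>2 + 2 * y\<^sup>2 = 2 * p" "D = 2"
      using k by auto
    \<comment> \<open>Here x must be even, and halving the equation with x = 2 z exchanges the roles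
      of the two squares: p = y^2 + 2 z^2.\<close>
    hence "x\<^sup>2 = 2 * (p - y\<^sup>2)"
      by simp
    hence "even (x\<^sup>2)"
      by simp
    then obtain z where "x = 2 * z"
      by (auto elim: evenE)
    with eq have "p = y\<^sup>2 + D * z\<^sup>2"
      by (simp add: power2_eq_square)
    thus ?thesis by blast
  qed
qed

text \<open>If y were invertible modulo p, dividing by y^2 would exhibit -D as a square.\<close>

lemma prime_dvd_form_imp_dvd:
  fixes p D :: int
  assumes "prime p" "\<not> QuadRes p (- D)" "p dvd x\<^sup>2 + D * y\<^sup>2"
  shows "p dvd x" "p dvd y"
proof -
  show y: "p dvd y"
  proof (rule ccontr)
    assume "\<not> p dvd y"
    hence "coprime y p"
      using assms(1) by (metis coprime_commute prime_imp_coprime)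
    then obtain z where "[y * z = 1] (mod p)"
      using cong_solve_coprime_int by blast
    hence "p dvd D * ((1 - y * z) * (1 + y * z))"
      by (metis cong_iff_dvd_diff cong_sym dvd_mult dvd_mult2)
    moreover have "p dvd z\<^sup>2 * (x\<^sup>2 + D * y\<^sup>2)"
      using assms(3) by simp
    ultimately have "p dvd z\<^sup>2 * (x\<^sup>2 + D * y\<^sup>2) + D * ((1 - y * z) * (1 + y * z))"
      by (metis dvd_add)
    also have "\<dots> = (x * z)\<^sup>2 - (- D)"
      by (simp add: algebra_simps power2_eq_square)
    finally have "QuadRes p (- D)"
      unfolding QuadRes_def cong_iff_dvd_diff by blast
    with assms(2) show False ..
  qed
  hence "p dvd (x\<^sup>2 + D * y\<^sup>2) - D * y\<^sup>2"
    using assms(3) by (intro dvd_diff) (auto simp: power2_eq_square)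
  thus "p dvd x"
    using assms(1) by (simp add: prime_dvd_power_iff)
qed

section \<open>Representation numbers as divisor sums\<close>

definition reps :: "int \<Rightarrow> int \<Rightarrow> (int \<times> int) set" where
  "reps D n = {(x, y). x\<^sup>2 + D * y\<^sup>2 = n}"

definition divsum :: "(int \<Rightarrow> int) \<Rightarrow> int \<Rightarrow> int" where
  "divsum f n = (\<Sum>d | 0 < d \<and> d dvd n. f d)"

lemma abs_le_square: "\<bar>x\<bar> \<le> (x::int)\<^sup>2"
proof -
  have "\<bar>x\<bar> * 1 \<le> \<bar>x\<bar> * \<bar>x\<bar>" if "x \<noteq> 0"
    using that by (intro mult_left_mono) auto
  thus ?thesis
    by (cases "x = 0") (auto simp: power2_eq_square)
qed

lemma square_le_imp: "(x::int)\<^sup>2 \<le> n \<Longrightarrow> - n \<le> x \<and> x \<le> n"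
  using abs_le_square [of x] by linarith

lemma finite_reps:
  assumes "D > 0"
  shows "finite (reps D n)"
proof (rule finite_subset)
  show "reps D n \<subseteq> {-n..n} \<times> {-n..n}"
  proof
    fix z assume "z \<in> reps D n"
    then obtain x y where z: "z = (x, y)" "x\<^sup>2 + D * y\<^sup>2 = n"
      by (auto simp: reps_def)
    have "1 * y\<^sup>2 \<le> D * y\<^sup>2"
      using assms by (intro mult_right_mono) auto
    hence "x\<^sup>2 \<le> n" "y\<^sup>2 \<le> n"
      using z(2) zero_le_power2 [of x] zero_le_power2 [of y] by linarith+
    with z(1) show "z \<in> {-n..n} \<times> {-n..n}"
      using square_le_imp [of x n] square_le_imp [of y n] by auto
  qed
qed auto

lemma finite_pos_divisors: "n > 0 \<Longrightarrow> finite {d::int. 0 < d \<and> d dvd n}"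
  by (rule finite_subset [of _ "{0..n}"]) (auto dest: zdvd_imp_le)

lemma card_reps_divisible:
  fixes p D n :: int
  assumes "prime p"
  shows "card {(x, y) \<in> reps D (p * n). p dvd x \<and> p dvd y} =
         (if p dvd n then card (reps D (n div p)) else 0)"
proof -
  have p0: "p > 0"
    using assms prime_gt_0_int by blast
  show ?thesis
  proof (cases "p dvd n")
    case True
    then obtain k where k: "n = p * k" by (auto elim: dvdE)
    have nk: "n div p = k"
      using k p0 by simp
    have sq: "(p * a)\<^sup>2 + D * (p * b)\<^sup>2 = p * p * (a\<^sup>2 + D * b\<^sup>2)" for a b
      by (simp add: algebra_simps power2_eq_square)
    have "{(x, y) \<in> reps D (p * n). p dvd x \<and> p dvd y} = (\<lambda>(a, b). (p * a, p * b)) ` reps D k"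
      using p0 by (auto simp: reps_def k dvd_def image_iff sq)
    moreover have "inj_on (\<lambda>(a, b). (p * a, p * b)) (reps D k)"
      using p0 by (auto simp: inj_on_def)
    ultimately show ?thesis
      using True nk by (simp add: card_image)
  next
    case False
    have empty: "{(x, y) \<in> reps D (p * n). p dvd x \<and> p dvd y} = {}"
    proof (rule ccontr)
      assume "{(x, y) \<in> reps D (p * n). p dvd x \<and> p dvd y} \<noteq> {}"
      then obtain a b where "(p * a)\<^sup>2 + D * (p * b)\<^sup>2 = p * n"
        by (auto simp: reps_def dvd_def)
      hence "p * (p * (a\<^sup>2 + D * b\<^sup>2)) = p * n"
        by (simp add: algebra_simps power2_eq_square)
      hence "n = p * (a\<^sup>2 + D * b\<^sup>2)"
        using p0 by simp
      with False show False by simp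
    qed
    show ?thesis
      unfolding empty using False by simp
  qed
qed

text \<open>When -D is not a square modulo p, p divides every element of Z[sqrt(-D)] whose norm it
  divides, so all solutions arise by scaling with p.\<close>

lemma card_reps_inert:
  fixes p D n :: int
  assumes "prime p" "\<not> QuadRes p (- D)"
  shows "card (reps D (p * n)) = (if p dvd n then card (reps D (n div p)) else 0)"
proof -
  have "p dvd x \<and> p dvd y" if "(x, y) \<in> reps D (p * n)" for x y
    using prime_dvd_form_imp_dvd [OF assms, of x y] that by (simp add: reps_def)
  hence "{(x, y) \<in> reps D (p * n). p dvd x \<and> p dvd y} = reps D (p * n)"
    by auto
  with card_reps_divisible [OF assms(1), of D n] show ?thesis
    by metis
qed

text \<open>Every element of norm \<open>p * n\<close> in \<open>\<int>[\<surd>-D]\<close> is divisible by \<open>u + v\<surd>-D\<close> or by its conjugate,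
  and by both iff it is divisible by \<open>p\<close>.\<close>

lemma card_reps_split:
  fixes p D n :: int
  assumes p: "prime p" "odd p" and D: "D = 1 \<or> D = 2" and uv: "u\<^sup>2 + D * v\<^sup>2 = p"
  shows "card (reps D (p * n)) + (if p dvd n then card (reps D (n div p)) else 0) = 2 * card (reps D n)"
proof -
  have p0: "p > 1"
    using p(1) prime_gt_1_int by blast
  have p2: "\<not> p dvd 2"
    using p p0 zdvd_imp_le [of p 2] by (cases "p = 2") auto
  hence pD: "\<not> p dvd D"
    using D p0 by auto
  have pv: "\<not> p dvd v"
  proof
    assume v: "p dvd v"
    hence "p dvd p - D * v\<^sup>2"
      by (auto simp: power2_eq_square)
    hence "p dvd u"
      using uv p(1) by (metis add_diff_cancel_right' prime_dvd_power)
    with v obtain a b where "u = p * a" "v = p * b"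
      by (auto elim!: dvdE)
    hence "u\<^sup>2 + D * v\<^sup>2 = p * (p * (a\<^sup>2 + D * b\<^sup>2))"
      by (simp add: algebra_simps power2_eq_square)
    hence "p * 1 = p * (p * (a\<^sup>2 + D * b\<^sup>2))"
      unfolding uv by simp
    hence "p * (a\<^sup>2 + D * b\<^sup>2) = 1"
      using p0 by simp
    hence "p dvd 1"
      by (metis dvd_triv_left)
    with p0 show False
      by simp
  qed
  have pu: "\<not> p dvd u"
  proof
    assume "p dvd u"
    hence "p dvd p - u\<^sup>2"
      by (auto simp: power2_eq_square)
    hence "p dvd D * v\<^sup>2"
      using uv by (metis add_diff_cancel_left')
    with pv pD p(1) show False
      by (simp add: prime_dvd_mult_iff prime_dvd_power_iff)
  qed
  let ?R = "reps D (p * n)"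
  \<comment> \<open>\<open>S w\<close> is the set of multiples of u + w sqrt(-D): the quantity y u -
    x w is the imaginary part of (x + y sqrt(-D)) (u - w sqrt(-D)).\<close>
  define S where "S = (\<lambda>w. {(x, y) \<in> ?R. p dvd y * u - x * w})"
  have fin: "finite (S w)" for w
    using finite_reps [of D "p * n"] D unfolding S_def by (auto intro: finite_subset [rotated])
  have cardS: "card (S w) = card (reps D n)" if w: "u\<^sup>2 + D * w\<^sup>2 = p" for w
  proof -
    \<comment> \<open>Multiplication of a + b sqrt(-D) by u + w sqrt(-D).\<close>
    let ?f = "\<lambda>(a, b). (a * u - D * b * w, a * w + b * u)"
    have "bij_betw ?f (reps D n) (S w)"
    proof (rule bij_betwI')
      fix s t assume "s \<in> reps D n" "t \<in> reps D n"
      obtain a b c d where st: "s = (a, b)" "t = (c, d)"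
        by fastforce
      have "a = c \<and> b = d" if "a * u - D * b * w = c * u - D * d * w" "a * w + b * u = c * w + d * u"
      proof -
        have "p * a = u * (a * u - D * b * w) + D * w * (a * w + b * u)"
             "p * b = u * (a * w + b * u) - w * (a * u - D * b * w)" 
             "p * c = u * (c * u - D * d * w) + D * w * (c * w + d * u)"
             "p * d = u * (c * w + d * u) - w * (c * u - D * d * w)" 
          unfolding w [symmetric] by (simp_all add: algebra_simps power2_eq_square)
        with that have "p * a = p * c" "p * b = p * d"
          by metis+
        thus ?thesis
          using p0 by simp
      qed
      with st show "(?f s = ?f t) = (s = t)"
        by auto
    next
      fix s assume "s \<in> reps D n"
      then obtain a b where s: "s = (a, b)" "a\<^sup>2 + D * b\<^sup>2 = n"
        by (auto simp: reps_def)
      have "(a * u - D * b * w)\<^sup>2 + D * (a * w + b * u)\<^sup>2 = p * n"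
        unfolding w [symmetric] s(2) [symmetric] by (simp add: algebra_simps power2_eq_square)
      moreover have "(a * w + b * u) * u - (a * u - D * b * w) * w = p * b"
        unfolding w [symmetric] by (simp add: algebra_simps power2_eq_square)
      ultimately show "?f s \<in> S w"
        using s by (simp add: S_def reps_def)
    next
      fix t assume "t \<in> S w"
      then obtain x y where t: "t = (x, y)" "x\<^sup>2 + D * y\<^sup>2 = p * n" "p dvd y * u - x * w"
        by (auto simp: S_def reps_def)
      \<comment> \<open>The norm of the product with the conjugate is p^2 n; since p divides the
        imaginary part, it divides the real part too, and the quotient by u + w sqrt(-D) is
        integral.\<close>
      have sq: "(x * u + D * y * w)\<^sup>2 = p * (p * n) - D * (y * u - x * w) * (y * u - x * w)"
        unfolding t(2) [symmetric] unfolding w [symmetric] by (simp add: algebra_simps power2_eq_square)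
      have "p dvd (x * u + D * y * w)\<^sup>2"
        unfolding sq using t(3) by simp
      hence "p dvd x * u + D * y * w"
        using p(1) by (simp add: prime_dvd_power_iff)
      then obtain a where a: "x * u + D * y * w = p * a"
        by (auto elim: dvdE)
      obtain b where b: "y * u - x * w = p * b"
        using t(3) by (auto elim: dvdE)
      have "p * x = u * (x * u + D * y * w) - D * w * (y * u - x * w)"
           "p * y = w * (x * u + D * y * w) + u * (y * u - x * w)"
        unfolding w [symmetric] by (simp_all add: algebra_simps power2_eq_square)
      hence "p * x = p * (a * u - D * b * w)" "p * y = p * (a * w + b * u)"
        unfolding a b by (simp_all add: algebra_simps)
      hence xy: "x = a * u - D * b * w" "y = a * w + b * u"
        using p0 by simp_all
      have "p * n = p * (a\<^sup>2 + D * b\<^sup>2)"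
        unfolding t(2) [symmetric] xy unfolding w [symmetric] by (simp add: algebra_simps power2_eq_square)
      hence "n = a\<^sup>2 + D * b\<^sup>2"
        using p0 by simp
      with t(1) xy show "\<exists>s\<in>reps D n. t = ?f s"
        by (intro bexI [of _ "(a, b)"]) (auto simp: reps_def)
    qed
    thus ?thesis
      by (simp add: bij_betw_same_card)
  qed
  have "?R \<subseteq> S v \<union> S (- v)"
  proof
    fix z assume "z \<in> ?R"
    then obtain x y where z: "z = (x, y)" "x\<^sup>2 + D * y\<^sup>2 = p * n"
      by (auto simp: reps_def)
    \<comment> \<open>The two divisibility conditions multiply to a combination of the two norms,
      both divisible by p; primality then selects one of the factors.\<close>
    have "(y * u - x * v) * (y * u + x * v) = y\<^sup>2 * (u\<^sup>2 + D * v\<^sup>2) - v\<^sup>2 * (x\<^sup>2 + D * y\<^sup>2)"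
      by (simp add: algebra_simps power2_eq_square)
    also have "\<dots> = y\<^sup>2 * p - v\<^sup>2 * (p * n)"
      using uv z(2) by simp
    finally have "p dvd (y * u - x * v) * (y * u + x * v)"
      by simp
    hence "p dvd y * u - x * v \<or> p dvd y * u + x * v"
      using p(1) by (simp add: prime_dvd_mult_iff)
    with z show "z \<in> S v \<union> S (- v)"
      by (auto simp: S_def reps_def)
  qed
  hence Un: "?R = S v \<union> S (- v)"
    by (auto simp: S_def)
  have Int: "S v \<inter> S (- v) = {(x, y) \<in> ?R. p dvd x \<and> p dvd y}"
  proof -
    have "p dvd x \<and> p dvd y" if "p dvd y * u - x * v" "p dvd y * u + x * v" for x y
    proof -
      have "p dvd (y * u - x * v) + (y * u + x * v)" "p dvd (y * u + x * v) - (y * u - x * v)"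
        using that by (metis dvd_add, metis dvd_diff)
      hence "p dvd 2 * (y * u)" "p dvd 2 * (x * v)"
        by (simp_all add: algebra_simps)
      thus ?thesis
        using p(1) p2 pu pv by (simp add: prime_dvd_mult_iff)
    qed
    hence iff: "p dvd y * u - x * v \<and> p dvd y * u + x * v \<longleftrightarrow> p dvd x \<and> p dvd y" for x y
      by (meson dvd_add dvd_diff dvd_mult2)
    have "(x, y) \<in> S v \<inter> S (- v) \<longleftrightarrow> (x, y) \<in> {(x, y) \<in> ?R. p dvd x \<and> p dvd y}" for x y
      using iff [of y x] unfolding S_def by auto
    thus ?thesis
      by auto
  qed
  have "card (S v) + card (S (- v)) = card ?R + card {(x, y) \<in> ?R. p dvd x \<and> p dvd y}"
    using card_Un_Int [OF fin fin, of v "- v"] Un Int by simp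
  moreover have "card (S v) = card (reps D n)" "card (S (- v)) = card (reps D n)"
    using uv by (auto intro!: cardS)
  ultimately show ?thesis
    using card_reps_divisible [OF p(1), of D n] by simp
qed

text \<open>Divisors of p n are divisors of n or p times divisors of n. The last term removes the
  overlap, which consists of p times the divisors of n / p.\<close>

lemma divsum_prime_mult:
  fixes p n :: int
  assumes p: "prime p" and n: "n > 0" and mult: "\<And>a b. f (a * b) = f a * f b"
  shows "divsum f (p * n) = divsum f n + f p * divsum f n - (if p dvd n then f p * divsum f (n div p) else 0)"
proof -
  have p0: "p > 0"
    using p prime_gt_0_int by blast
  let ?D = "\<lambda>n. {d. 0 < d \<and> d dvd n}"
  have sub: "?D (p * n) = ?D n \<union> (*) p ` ?D n"
  proof -
    have "d dvd n \<or> (\<exists>e. d = p * e \<and> 0 < e \<and> e dvd n)" if "0 < d" "d dvd p * n" for d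
    proof (cases "p dvd d")
      case True
      then obtain e where "d = p * e" by (auto elim: dvdE)
      with that p0 show ?thesis
        by (auto simp: zero_less_mult_iff)
    next
      case False
      hence "coprime d p"
        using p by (metis coprime_commute prime_imp_coprime)
      with that show ?thesis
        by (simp add: coprime_dvd_mult_right_iff)
    qed
    thus ?thesis
      using p0 by (auto simp: image_iff)
  qed
  have "sum f (?D (p * n)) = sum f (?D n) + sum f ((*) p ` ?D n) - sum f (?D n \<inter> (*) p ` ?D n)"
    unfolding sub using finite_pos_divisors [OF n] by (subst sum_Un) auto
  moreover have im: "sum f ((*) p ` ?D k) = f p * sum f (?D k)" for k
    using p0 by (subst sum.reindex) (auto simp: inj_on_def mult sum_distrib_left)
  moreover have "sum f (?D n \<inter> (*) p ` ?D n) = (if p dvd n then f p * sum f (?D (n div p)) else 0)"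
  proof (cases "p dvd n")
    case True
    then obtain k where k: "n = p * k" by (auto elim: dvdE)
    have "?D n \<inter> (*) p ` ?D n = (*) p ` ?D k"
      using p0 k by auto
    with im True k p0 show ?thesis by simp
  next
    case False
    hence "?D n \<inter> (*) p ` ?D n = {}"
      by (auto dest: dvd_mult_left)
    with False show ?thesis by simp
  qed
  ultimately show ?thesis
    by (simp add: divsum_def)
qed

text \<open>Both sides satisfy F(p k) = (1 + f p) F(k) - f p F(k / p), with the last term absent
  unless p divides k: f p = 1 is the split case, f p = -1 the inert one. Induction removes one prime
  at a time and ends at n = 1.\<close>

lemma card_reps_eq_divsum:
  fixes D :: int
  assumes D: "D = 1 \<or> D = 2"
    and mult: "\<And>a b. f (a * b) = f a * f b" and f1: "f 1 = 1"
    and f: "\<And>p. prime p \<Longrightarrow> odd p \<Longrightarrow> f p = Legendre (- D) p"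
  shows "odd n \<Longrightarrow> n > 0 \<Longrightarrow> int (card (reps D n)) = int (card (reps D 1)) * divsum f n"
proof (induction "nat n" arbitrary: n rule: less_induct)
  case less
  show ?case
  proof (cases "n = 1")
    case True
    have "{d::int. 0 < d \<and> d dvd 1} = {1}"
      by auto
    with True f1 show ?thesis
      by (simp add: divsum_def)
  next
    case False
    then obtain p where p: "prime p" "p dvd n"
      using less.prems prime_divisor_exists [of n] by auto
    then obtain k where k: "n = p * k" by (auto elim: dvdE)
    have p0: "p > 1"
      using p(1) prime_gt_1_int by blast
    have odd: "odd p" "odd k"
      using k less.prems(1) by auto
    have k0: "k > 0"
      using k less.prems(2) p0 by (simp add: zero_less_mult_iff)
    have "k < n"
      using k k0 p0 by simp
    hence "nat k < nat n"
      using k0 by simp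
    hence IHk: "int (card (reps D k)) = int (card (reps D 1)) * divsum f k"
      using less.hyps [of k] odd k0 by blast
    have IHq: "int (card (reps D (k div p))) = int (card (reps D 1)) * divsum f (k div p)" if pk: "p dvd k"
    proof -
      obtain q where q: "k = p * q" using pk by (auto elim: dvdE)
      have q0: "q > 0"
        using q k0 p0 by (simp add: zero_less_mult_iff)
      have "q < k"
        using q q0 p0 by simp
      hence "nat q < nat n"
        using \<open>k < n\<close> k0 by simp
      moreover have "odd q" "k div p = q"
        using q odd p0 by auto
      ultimately show ?thesis
        using less.hyps [of q] q0 by simp
    qed
    have ds: "divsum f n = divsum f k + f p * divsum f k - (if p dvd k then f p * divsum f (k div p) else 0)"
      unfolding k by (rule divsum_prime_mult [OF p(1) k0 mult])
    have "\<not> p dvd D"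
      using D p0 odd zdvd_imp_le [of p 2] by (cases "p = 2") auto
    hence L: "f p = (if QuadRes p (- D) then 1 else -1)"
      using f [OF p(1) odd(1)] by (simp add: Legendre_def cong_0_iff)
    show ?thesis
    proof (cases "QuadRes p (- D)")
      case True
      then obtain u v where "u\<^sup>2 + D * v\<^sup>2 = p"
        using prime_is_form [OF p(1) D] by metis
      from card_reps_split [OF p(1) odd(1) D this, of k]
      have "int (card (reps D n)) + (if p dvd k then int (card (reps D (k div p))) else 0)
            = 2 * int (card (reps D k))"
        unfolding k by (auto split: if_splits)
      with IHk IHq L True show ?thesis
        unfolding ds by (auto simp: algebra_simps)
    next
      case False
      with card_reps_inert [OF p(1) False, of k] IHk IHq L show ?thesis
        unfolding ds unfolding k by (auto simp: algebra_simps)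
    qed
  qed
qed

lemma card_reps_1_odd:
  assumes "odd n" "n > 0"
  shows "int (card (reps 1 n)) = 4 * divsum chi4 n"
proof -
  have "reps 1 1 = {(1, 0), (-1, 0), (0, 1), (0, -1)}"
  proof -
    have "(x, y) \<in> {(1, 0), (-1, 0), (0, 1), (0, -1)}" if "x\<^sup>2 + y\<^sup>2 = 1" for x y :: int
    proof -
      have "x\<^sup>2 \<le> 1" "y\<^sup>2 \<le> 1"
        using that zero_le_power2 [of x] zero_le_power2 [of y] by linarith+
      hence "x \<in> {-1, 0, 1}" "y \<in> {-1, 0, 1}"
        using square_le_imp [of x 1] square_le_imp [of y 1] by auto
      with that show ?thesis by auto
    qed
    thus ?thesis by (auto simp: reps_def)
  qed
  hence "card (reps 1 1) = 4"
    by simp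
  moreover have "chi4 p = Legendre (- 1) p" if "prime p" "odd p" for p
    using Legendre_minus_1 [of "nat p"] that prime_gt_0_int [of p] by (simp add: even_nat_iff)
  moreover have "chi4 1 = 1"
    by (simp add: chi4_def)
  ultimately show ?thesis
    using card_reps_eq_divsum [of 1 chi4 n] chi4_mult assms by simp
qed

lemma card_reps_2_odd:
  assumes "odd n" "n > 0"
  shows "int (card (reps 2 n)) = 2 * divsum (\<lambda>d. chi4 d * chi8 d) n"
proof -
  have "reps 2 1 = {(1, 0), (-1, 0)}"
  proof -
    have "(x, y) \<in> {(1, 0), (-1, 0)}" if "x\<^sup>2 + 2 * y\<^sup>2 = 1" for x y :: int
    proof -
      have "x\<^sup>2 \<le> 1" "y\<^sup>2 \<le> 0"
        using that zero_le_power2 [of x] zero_le_power2 [of y] by linarith+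
      hence "x \<in> {-1, 0, 1}" "y = 0"
        using square_le_imp [of x 1] by auto
      with that show ?thesis by auto
    qed
    thus ?thesis by (auto simp: reps_def)
  qed
  hence "card (reps 2 1) = 2"
    by simp
  moreover have "chi4 p * chi8 p = Legendre (- 2) p" if "prime p" "odd p" for p
    using Legendre_minus_2 [of "nat p"] that prime_gt_0_int [of p] by (simp add: even_nat_iff)
  moreover have "chi4 1 * chi8 1 = 1"
    by (simp add: chi4_def chi8_def)
  ultimately show ?thesis
    using card_reps_eq_divsum [of 2 "\<lambda>d. chi4 d * chi8 d" n] chi4_mult chi8_mult assms
    by (simp add: mult_ac)
qed

text \<open>The map is conjugation followed by multiplication by 1 + i; it reaches every solution
  for 2 n because x and y then have equal parity.\<close>

lemma card_reps_1_double: "card (reps 1 (2 * n)) = card (reps 1 n)"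
proof -
  have "bij_betw (\<lambda>(x, y). (x + y, x - y)) (reps 1 n) (reps 1 (2 * n))"
  proof (rule bij_betw_byWitness [where f' = "\<lambda>(x, y). ((x + y) div 2, (x - y) div 2)"])
    show "(\<lambda>(x, y). ((x + y) div 2, (x - y) div 2)) ` reps 1 (2 * n) \<subseteq> reps 1 n"
    proof safe
      fix x y assume "(x, y) \<in> reps 1 (2 * n)"
      hence xy: "x\<^sup>2 + y\<^sup>2 = 2 * n"
        by (simp add: reps_def)
      hence "even (x\<^sup>2 + y\<^sup>2)"
        by simp
      hence "even (x + y)"
        by simp
      then obtain a where a: "x + y = 2 * a" by (rule evenE)
      hence x: "x = 2 * a - y" by simp
      hence "x - y = 2 * (a - y)" by simp
      hence "(x + y) div 2 = a" "(x - y) div 2 = a - y"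
        using a by simp_all
      moreover have "a\<^sup>2 + (a - y)\<^sup>2 = n"
        using xy unfolding x by (simp add: power2_eq_square algebra_simps)
      ultimately show "((x + y) div 2, (x - y) div 2) \<in> reps 1 n"
        by (simp add: reps_def)
    qed
    have "(x + y) div 2 + (x - y) div 2 = x \<and> (x + y) div 2 - (x - y) div 2 = y"
      if "(x, y) \<in> reps 1 (2 * n)" for x y
    proof -
      have "even (x\<^sup>2 + y\<^sup>2)"
        using that by (simp add: reps_def)
      hence "even (x + y)"
        by simp
      thus ?thesis
        by presburger
    qed
    thus "\<forall>a\<in>reps 1 (2 * n). (case case a of (x, y) \<Rightarrow> ((x + y) div 2, (x - y) div 2) of (x, y) \<Rightarrow> (x + y, x - y)) = a"
      by auto
  qed (auto simp: reps_def power2_eq_square algebra_simps)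
  thus ?thesis
    by (simp add: bij_betw_same_card)
qed

lemma card_reps_1:
  assumes "n > 0"
  shows "int (card (reps 1 n)) = 4 * divsum chi4 n"
  using assms
proof (induction "nat n" arbitrary: n rule: less_induct)
  case less
  show ?case
  proof (cases "even n")
    case False
    with less.prems show ?thesis by (simp add: card_reps_1_odd)
  next
    case True
    then obtain k where k: "n = 2 * k" by (auto elim: evenE)
    \<comment> \<open>As \<open>chi4 2 = 0\<close>, a factor 2 changes neither the divisor sum nor
      the number of representations.\<close>
    have "divsum chi4 (2 * k) = divsum chi4 k"
      using divsum_prime_mult [of 2 k chi4] less.prems k chi4_mult chi4_even [of 2] by simp
    with less.hyps [of k] less.prems k show ?thesis
      by (simp add: card_reps_1_double)
  qed
qed

section \<open>A Liouville-type convolution identity\<close>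

text \<open>Factorizations N = a x and 4k - N = b y of two odd numbers with sum 4k, the index set
  for a convolution of two divisor sums.\<close>

definition odd_quads :: "int \<Rightarrow> (int \<times> int \<times> int \<times> int) set" where
  "odd_quads k = {(a, x, b, y). odd a \<and> odd x \<and> odd b \<and> odd y \<and>
     a > 0 \<and> x > 0 \<and> b > 0 \<and> y > 0 \<and> a * x + b * y = 4 * k}"

text \<open>The common target of the substitutions x - y = 8 j and x + y = 8 j in
  \<open>odd_quads\<close>.\<close>

definition mixed_quads :: "int \<Rightarrow> (int \<times> int \<times> int \<times> int) set" where
  "mixed_quads k = {(c, x, j, b). even c \<and> odd x \<and> odd b \<and>
     c > 0 \<and> x > 0 \<and> j > 0 \<and> b > 0 \<and> c * x + 8 * j * b = 4 * k}"

lemma factors_le_of_sum_eq: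
  fixes a x b y n :: int
  assumes "a > 0" "x > 0" "b > 0" "y > 0" "a * x + b * y = n"
  shows "a \<le> n" "x \<le> n" "b \<le> n" "y \<le> n"
proof -
  have "a * 1 \<le> a * x" "1 * x \<le> a * x" "b * 1 \<le> b * y" "1 * y \<le> b * y"
    using assms(1-4) by (intro mult_left_mono mult_right_mono; simp)+
  moreover have "a * x > 0" "b * y > 0"
    using assms(1-4) by simp_all
  ultimately show "a \<le> n" "x \<le> n" "b \<le> n" "y \<le> n"
    using assms(5) by linarith+
qed

lemma finite_odd_quads: "finite (odd_quads k)"
proof (rule finite_subset)
  show "odd_quads k \<subseteq> {0..4*k} \<times> {0..4*k} \<times> {0..4*k} \<times> {0..4*k}"
  proof
    fix z assume "z \<in> odd_quads k"
    then obtain a x b y where z: "z = (a, x, b, y)" "a > 0" "x > 0" "b > 0" "y > 0"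
      "a * x + b * y = 4 * k"
      by (auto simp: odd_quads_def)
    from factors_le_of_sum_eq [OF z(2-6)] z
    show "z \<in> {0..4*k} \<times> {0..4*k} \<times> {0..4*k} \<times> {0..4*k}"
      by simp
  qed
qed auto

lemma finite_mixed_quads: "finite (mixed_quads k)"
proof (rule finite_subset)
  show "mixed_quads k \<subseteq> {0..4*k} \<times> {0..4*k} \<times> {0..4*k} \<times> {0..4*k}"
  proof
    fix z assume "z \<in> mixed_quads k"
    then obtain c x j b where z: "z = (c, x, j, b)" "c > 0" "x > 0" "j > 0" "b > 0"
      "c * x + (8 * j) * b = 4 * k"
      by (auto simp: mixed_quads_def)
    from factors_le_of_sum_eq [OF z(2,3) _ z(5,6)] z
    show "z \<in> {0..4*k} \<times> {0..4*k} \<times> {0..4*k} \<times> {0..4*k}"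
      by simp
  qed
qed auto

text \<open>The left side is chi4(x y) (chi8 x + chi8 y). The bracket vanishes unless x = y or x =
  -y modulo 8, and in these cases the first factor is 1 and -1 respectively.\<close>

lemma chi_symmetrized:
  assumes "odd x" "odd y"
  shows "chi4 x * (chi4 y * chi8 y) + chi4 y * (chi4 x * chi8 x) =
    2 * (if 8 dvd x - y then chi8 x else 0) - 2 * (if 8 dvd x + y then chi8 x else 0)"
proof -
  have *: "chi4 r * (chi4 s * chi8 s) + chi4 s * (chi4 r * chi8 r) =
    2 * (if r = s then chi8 r else 0) - 2 * (if r + s = 8 then chi8 r else 0)"
    if "r \<in> {1, 3, 5, 7}" "s \<in> {1, 3, 5, 7}" for r s
    using that by (elim insertE emptyE) (simp_all add: chi4_def chi8_def)
  have c4: "chi4 (z mod 8) = chi4 z" for z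
    unfolding chi4_def by (simp add: mod_mod_cancel)
  have "x mod 8 \<in> {1, 3, 5, 7}" "y mod 8 \<in> {1, 3, 5, 7}"
    using assms by (simp_all, presburger+)
  note * [OF this]
  moreover have "8 dvd x - y \<longleftrightarrow> x mod 8 = y mod 8"
    by (simp add: mod_eq_dvd_iff)
  moreover have "8 dvd x + y \<longleftrightarrow> x mod 8 + y mod 8 = 8"
    using assms by presburger
  ultimately show ?thesis
    by (simp only: c4 chi8_mod)
qed

text \<open>With x = y + 8 j the equation reads (a + b) y + 8 j a = 4k. The inequality on the right
  expresses that the old b is positive.\<close>

lemma sum_odd_quads_diff:
  "(\<Sum>(a, x, b, y) \<in> {(a, x, b, y) \<in> odd_quads k. 8 dvd x - y \<and> y < x}. chi8 x) =
   (\<Sum>(c, x, j, b) \<in> {(c, x, j, b) \<in> mixed_quads k. b < c}. chi8 x)"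
proof -
  let ?g = "\<lambda>(c, x, j, b). (b, x + 8 * j, c - b, x)"
  let ?B = "{(c, x, j, b) \<in> mixed_quads k. b < c}"
  have "{(a, x, b, y) \<in> odd_quads k. 8 dvd x - y \<and> y < x} = ?g ` ?B"
  proof (intro equalityI subsetI)
    fix z assume "z \<in> {(a, x, b, y) \<in> odd_quads k. 8 dvd x - y \<and> y < x}"
    then obtain a x b y where z: "z = (a, x, b, y)" "(a, x, b, y) \<in> odd_quads k" "8 dvd x - y" "y < x"
      by auto
    then obtain j where "x - y = 8 * j"
      by (auto elim: dvdE)
    hence x: "x = y + 8 * j" and j: "j > 0"
      using z(4) by auto
    have "(a + b, y, j, a) \<in> ?B"
      using z(2) j unfolding x odd_quads_def mixed_quads_def by (auto simp: algebra_simps)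
    moreover have "z = ?g (a + b, y, j, a)"
      by (simp add: z x)
    ultimately show "z \<in> ?g ` ?B"
      by blast
  qed (auto simp: odd_quads_def mixed_quads_def algebra_simps)
  moreover have "inj_on ?g ?B"
    by (auto simp: inj_on_def)
  ultimately show ?thesis
    by (simp add: sum.reindex case_prod_unfold chi8_add_8)
qed

text \<open>With y = 8 j - x the equation reads (a - b) x + 8 j b = 4k. The inequality on the right
  expresses that y is positive.\<close>

lemma sum_odd_quads_sum:
  "(\<Sum>(a, x, b, y) \<in> {(a, x, b, y) \<in> odd_quads k. 8 dvd x + y \<and> b < a}. chi8 x) =
   (\<Sum>(c, x, j, b) \<in> {(c, x, j, b) \<in> mixed_quads k. x < 8 * j}. chi8 x)"
proof -
  let ?g = "\<lambda>(c, x, j, b). (c + b, x, b, 8 * j - x)"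
  let ?B = "{(c, x, j, b) \<in> mixed_quads k. x < 8 * j}"
  have "{(a, x, b, y) \<in> odd_quads k. 8 dvd x + y \<and> b < a} = ?g ` ?B"
  proof (intro equalityI subsetI)
    fix z assume "z \<in> {(a, x, b, y) \<in> odd_quads k. 8 dvd x + y \<and> b < a}"
    then obtain a x b y where z: "z = (a, x, b, y)" "(a, x, b, y) \<in> odd_quads k" "8 dvd x + y" "b < a"
      by auto
    then obtain j where "x + y = 8 * j"
      by (auto elim: dvdE)
    hence y: "y = 8 * j - x"
      by simp
    have "(a - b, x, j, b) \<in> ?B"
      using z(2,4) unfolding y odd_quads_def mixed_quads_def by (auto simp: algebra_simps)
    moreover have "z = ?g (a - b, x, j, b)"
      by (simp add: z y)
    ultimately show "z \<in> ?g ` ?B"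
      by blast
  qed (auto simp: odd_quads_def mixed_quads_def algebra_simps)
  moreover have "inj_on ?g ?B"
    by (auto simp: inj_on_def)
  ultimately show ?thesis
    by (simp add: sum.reindex case_prod_unfold)
qed

text \<open>The identity c x + 8 j b = c (x - 8 j) + 8 j (b + c) preserves the equation while x
  changes by a multiple of 8. Parity excludes x = 8 j and b = c.\<close>

lemma sum_mixed_quads_flip:
  "(\<Sum>(c, x, j, b) \<in> {(c, x, j, b) \<in> mixed_quads k. \<not> x < 8 * j}. chi8 x) =
   (\<Sum>(c, x, j, b) \<in> {(c, x, j, b) \<in> mixed_quads k. \<not> b < c}. chi8 x)"
proof -
  let ?g = "\<lambda>(c, x, j, b). (c, x + 8 * j, j, b - c)"
  let ?B = "{(c, x, j, b) \<in> mixed_quads k. \<not> b < c}"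
  have "{(c, x, j, b) \<in> mixed_quads k. \<not> x < 8 * j} = ?g ` ?B"
  proof (intro equalityI subsetI)
    fix z assume "z \<in> {(c, x, j, b) \<in> mixed_quads k. \<not> x < 8 * j}"
    then obtain c x j b where z: "z = (c, x, j, b)" "(c, x, j, b) \<in> mixed_quads k" "8 * j \<le> x"
      by auto
    moreover from this have "8 * j \<noteq> x"
      by (auto simp: mixed_quads_def)
    ultimately have "(c, x - 8 * j, j, b + c) \<in> ?B"
      unfolding mixed_quads_def by (auto simp: algebra_simps)
    moreover have "z = ?g (c, x - 8 * j, j, b + c)"
      by (simp add: z)
    ultimately show "z \<in> ?g ` ?B"
      by blast
  next
    fix z assume "z \<in> ?g ` ?B"
    then obtain c x j b where z: "z = (c, x + 8 * j, j, b - c)" "(c, x, j, b) \<in> mixed_quads k" "c \<le> b"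
      by auto
    moreover from this have "c \<noteq> b"
      by (auto simp: mixed_quads_def)
    ultimately show "z \<in> {(c, x, j, b) \<in> mixed_quads k. \<not> x < 8 * j}"
      unfolding mixed_quads_def by (auto simp: algebra_simps)
  qed
  moreover have "inj_on ?g ?B"
    by (auto simp: inj_on_def)
  ultimately show ?thesis
    by (simp add: sum.reindex case_prod_unfold chi8_add_8)
qed

lemma sum_filter_split:
  fixes f :: "'a \<Rightarrow> int"
  assumes "finite A"
  shows "sum f A = sum f {z \<in> A. P z} + sum f {z \<in> A. \<not> P z}"
proof -
  have "A = {z \<in> A. P z} \<union> {z \<in> A. \<not> P z}"
    by auto
  thus ?thesis
    using assms by (metis (no_types, lifting) sum.union_disjoint finite_Un disjoint_iff mem_Collect_eq)
qed

text \<open>The total over \<open>mixed_quads\<close> is split in two ways, and the complementary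
  parts agree by the flip.\<close>

lemma sum_mixed_quads_eq:
  "(\<Sum>(c, x, j, b) \<in> {(c, x, j, b) \<in> mixed_quads k. b < c}. chi8 x) =
   (\<Sum>(c, x, j, b) \<in> {(c, x, j, b) \<in> mixed_quads k. x < 8 * j}. chi8 x)"
  using sum_filter_split [OF finite_mixed_quads, of "\<lambda>(c, x, j, b). chi8 x" k "\<lambda>(c, x, j, b). b < c"]
    sum_filter_split [OF finite_mixed_quads, of "\<lambda>(c, x, j, b). chi8 x" k "\<lambda>(c, x, j, b). x < 8 * j"]
    sum_mixed_quads_flip [of k]
  by (simp add: case_prod_unfold)

lemma card_odd_below: "K \<ge> 0 \<Longrightarrow> card {a::int. odd a \<and> 0 < a \<and> a < 4 * K} = nat (2 * K)"
proof -
  have "{a::int. odd a \<and> 0 < a \<and> a < 4 * K} = (\<lambda>i. 2 * i + 1) ` {0..<2 * K}"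
    by (auto elim!: oddE)
  thus ?thesis
    by (simp add: card_image inj_on_def)
qed

text \<open>For x = y = d the equation is d (a + b) = 4k. As d is odd it divides k, and 2 (k / d)
  odd values of a remain.\<close>

lemma sum_odd_quads_diag:
  assumes "odd k" "k > 0"
  shows "(\<Sum>(a, x, b, y) \<in> {(a, x, b, y) \<in> odd_quads k. x = y}. chi8 x) =
    2 * (\<Sum>d | 0 < d \<and> d dvd k. (k div d) * chi8 d)"
proof -
  let ?D = "{d. 0 < d \<and> d dvd k}"
  let ?A = "\<lambda>d. {a::int. odd a \<and> 0 < a \<and> a < 4 * (k div d)}"
  let ?g = "\<lambda>(d, a). (a, d, 4 * (k div d) - a, d)"
  have finA: "finite (?A d)" for d
    by (rule finite_subset [of _ "{0..4 * (k div d)}"]) auto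
  have "{(a, x, b, y) \<in> odd_quads k. x = y} = ?g ` (SIGMA d:?D. ?A d)"
  proof (intro equalityI subsetI)
    fix z assume "z \<in> {(a, x, b, y) \<in> odd_quads k. x = y}"
    then obtain a d b where z: "z = (a, d, b, d)" "odd a" "odd d" "odd b" "a > 0" "d > 0" "b > 0"
      "a * d + b * d = 4 * k"
      by (auto simp: odd_quads_def)
    have "d * (a + b) = 4 * k"
      using z(8) by (simp add: algebra_simps)
    hence "d dvd 4 * k"
      by (metis dvd_triv_left)
    moreover have "coprime d (2 ^ 2)"
      using z(3) by (simp only: coprime_power_right_iff coprime_right_2_iff_odd) simp
    hence "coprime d 4"
      by simp
    ultimately have "d dvd k"
      by (simp add: coprime_dvd_mult_right_iff)
    then obtain q where q: "k = d * q"
      by (auto elim: dvdE)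
    have "d * (a + b) = d * (4 * q)"
      using \<open>d * (a + b) = 4 * k\<close> q by simp
    hence "a + b = 4 * q"
      using z(6) by simp
    moreover have "k div d = q"
      using q z(6) by simp
    ultimately have "b = 4 * (k div d) - a"
      by simp
    moreover have "(d, a) \<in> (SIGMA d:?D. ?A d)"
      using z \<open>d dvd k\<close> \<open>a + b = 4 * q\<close> \<open>k div d = q\<close> by auto
    ultimately show "z \<in> ?g ` (SIGMA d:?D. ?A d)"
      using z(1) by (intro image_eqI [of _ _ "(d, a)"]) auto
  next
    fix z assume "z \<in> ?g ` (SIGMA d:?D. ?A d)"
    then obtain d a where z: "z = (a, d, 4 * (k div d) - a, d)" "0 < d" "d dvd k"
      "odd a" "0 < a" "a < 4 * (k div d)"
      by auto
    from z(3) obtain q where q: "k = d * q"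
      by (auto elim: dvdE)
    have "k div d = q" "odd d"
      using q z(2) assms(1) by auto
    with z q show "z \<in> {(a, x, b, y) \<in> odd_quads k. x = y}"
      by (auto simp: odd_quads_def algebra_simps)
  qed
  moreover have "inj_on ?g (SIGMA d:?D. ?A d)"
    by (auto simp: inj_on_def)
  ultimately have "(\<Sum>(a, x, b, y) \<in> {(a, x, b, y) \<in> odd_quads k. x = y}. chi8 x) =
      (\<Sum>(d, a) \<in> (SIGMA d:?D. ?A d). chi8 d)"
    by (simp add: sum.reindex case_prod_unfold)
  also have "\<dots> = (\<Sum>d\<in>?D. \<Sum>a\<in>?A d. chi8 d)"
    using finite_pos_divisors [OF assms(2)] finA by (subst sum.Sigma) auto
  also have "\<dots> = (\<Sum>d\<in>?D. 2 * ((k div d) * chi8 d))"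
  proof (rule sum.cong)
    fix d assume "d \<in> ?D"
    hence "k div d \<ge> 0"
      using assms(2) by (simp add: pos_imp_zdiv_nonneg_iff)
    thus "(\<Sum>a\<in>?A d. chi8 d) = 2 * ((k div d) * chi8 d)"
      by (simp add: card_odd_below)
  qed auto
  finally show ?thesis
    by (simp add: sum_distrib_left)
qed

lemma sum_odd_quads_swap:
  "(\<Sum>(a, x, b, y) \<in> {(a, x, b, y) \<in> odd_quads k. P a x b y}. f a x b y :: int) =
   (\<Sum>(a, x, b, y) \<in> {(a, x, b, y) \<in> odd_quads k. P b y a x}. f b y a x)"
  by (rule sum.reindex_bij_witness [of _ "\<lambda>(a, x, b, y). (b, y, a, x)" "\<lambda>(a, x, b, y). (b, y, a, x)"])
     (auto simp: odd_quads_def)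

text \<open>Twice the sum is symmetrized by exchanging (a, x) with (b, y). The diagonal gives the
  right side; by the same exchange each off-diagonal family is twice one of its halves, and these
  halves reduce to the two equal sums over \<open>mixed_quads\<close>.\<close>

lemma sum_odd_quads_chi:
  assumes "odd k" "k > 0"
  shows "(\<Sum>(a, x, b, y) \<in> odd_quads k. chi4 x * (chi4 y * chi8 y)) =
    2 * (\<Sum>d | 0 < d \<and> d dvd k. (k div d) * chi8 d)" (is "?S = ?R")
proof -
  let ?Q = "odd_quads k"
  have filter: "(\<Sum>(a, x, b, y) \<in> ?Q. if P a x b y then f x else 0) =
      (\<Sum>(a, x, b, y) \<in> {(a, x, b, y) \<in> ?Q. P a x b y}. f x)" for P and f :: "int \<Rightarrow> int"
  proof -
    have "{(a, x, b, y) \<in> ?Q. P a x b y} = {z \<in> ?Q. case z of (a, x, b, y) \<Rightarrow> P a x b y}"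
      by auto
    thus ?thesis
      using finite_odd_quads [of k] by (simp add: sum.inter_filter) (intro sum.cong, auto)
  qed
  have "2 * ?S = ?S + (\<Sum>(a, x, b, y) \<in> ?Q. chi4 y * (chi4 x * chi8 x))"
    using sum_odd_quads_swap [of "\<lambda>a x b y. chi4 x * (chi4 y * chi8 y)" k "\<lambda>_ _ _ _. True"] by simp
  also have "\<dots> = (\<Sum>(a, x, b, y) \<in> ?Q. chi4 x * (chi4 y * chi8 y) + chi4 y * (chi4 x * chi8 x))"
    by (simp add: sum.distrib case_prod_unfold)
  also have "\<dots> = (\<Sum>(a, x, b, y) \<in> ?Q. 2 * (if 8 dvd x - y then chi8 x else 0)
                        - 2 * (if 8 dvd x + y then chi8 x else 0))"
    by (intro sum.cong refl) (auto simp: chi_symmetrized odd_quads_def)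
  also have "\<dots> = 2 * (\<Sum>(a, x, b, y) \<in> ?Q. if 8 dvd x - y then chi8 x else 0)
                 - 2 * (\<Sum>(a, x, b, y) \<in> ?Q. if 8 dvd x + y then chi8 x else 0)"
    by (simp add: sum_subtractf sum_distrib_left case_prod_unfold)
  also have "(\<Sum>(a, x, b, y) \<in> ?Q. if 8 dvd x - y then chi8 x else 0) =
      (\<Sum>(a, x, b, y) \<in> ?Q. (if x = y then chi8 x else 0)
         + (if 8 dvd x - y \<and> y < x then chi8 x else 0) + (if 8 dvd x - y \<and> x < y then chi8 x else 0))"
    by (intro sum.cong refl) auto
  also have "\<dots> = ?R + (\<Sum>(a, x, b, y) \<in> {(a, x, b, y) \<in> ?Q. 8 dvd x - y \<and> y < x}. chi8 x)
      + (\<Sum>(a, x, b, y) \<in> {(a, x, b, y) \<in> ?Q. 8 dvd x - y \<and> x < y}. chi8 x)"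
    unfolding sum_odd_quads_diag [OF assms, symmetric] filter [symmetric]
    by (simp add: sum.distrib case_prod_unfold)
  also have "(\<Sum>(a, x, b, y) \<in> {(a, x, b, y) \<in> ?Q. 8 dvd x - y \<and> x < y}. chi8 x) =
      (\<Sum>(a, x, b, y) \<in> {(a, x, b, y) \<in> ?Q. 8 dvd x - y \<and> y < x}. chi8 x)"
  proof -
    have "chi8 y = chi8 x" if "8 dvd y - x" for x y
      using that chi8_mod by (metis mod_eq_dvd_iff)
    thus ?thesis
      by (subst sum_odd_quads_swap) (intro sum.cong, auto simp: dvd_diff_commute)
  qed
  also have "(\<Sum>(a, x, b, y) \<in> ?Q. if 8 dvd x + y then chi8 x else 0) =
      (\<Sum>(a, x, b, y) \<in> ?Q. (if 8 dvd x + y \<and> b < a then chi8 x else 0)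
         + (if 8 dvd x + y \<and> a < b then chi8 x else 0))"
  proof (intro sum.cong refl, safe)
    fix a x b y assume "(a, x, b, y) \<in> ?Q"
    hence *: "odd a" "a * x + b * y = 4 * k"
      by (auto simp: odd_quads_def)
    \<comment> \<open>The case a = b drops out: it would give 4k = 8 a j and make k even.\<close>
    have "\<not> 8 dvd x + y" if "a = b"
    proof
      assume "8 dvd x + y"
      then obtain j where "x + y = 8 * j"
        by (auto elim: dvdE)
      with * that have "4 * k = 4 * (2 * (a * j))"
        by (simp add: algebra_simps flip: distrib_left)
      with assms(1) show False
        by simp
    qed
    thus "(if 8 dvd x + y then chi8 x else 0) =
       (if 8 dvd x + y \<and> b < a then chi8 x else 0) + (if 8 dvd x + y \<and> a < b then chi8 x else 0)"
      by auto
  qed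
  also have "\<dots> = (\<Sum>(a, x, b, y) \<in> {(a, x, b, y) \<in> ?Q. 8 dvd x + y \<and> b < a}. chi8 x)
      + (\<Sum>(a, x, b, y) \<in> {(a, x, b, y) \<in> ?Q. 8 dvd x + y \<and> a < b}. chi8 x)"
    unfolding filter [symmetric] by (simp add: sum.distrib case_prod_unfold)
  also have "(\<Sum>(a, x, b, y) \<in> {(a, x, b, y) \<in> ?Q. 8 dvd x + y \<and> a < b}. chi8 x) =
      (\<Sum>(a, x, b, y) \<in> {(a, x, b, y) \<in> ?Q. 8 dvd x + y \<and> b < a}. chi8 x)"
  proof -
    have "chi8 y = chi8 x" if "8 dvd y + x" for x y
    proof -
      obtain j where "y + x = 8 * j"
        using \<open>8 dvd y + x\<close> by (auto elim: dvdE)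
      hence "y = (-1) * x + 8 * j"
        by simp
      hence "chi8 y = chi8 ((-1) * x)"
        by (simp only: chi8_add_8)
      also have "\<dots> = chi8 x"
        unfolding chi8_mult by (simp add: chi8_def)
      finally show ?thesis .
    qed
    thus ?thesis
      by (subst sum_odd_quads_swap) (intro sum.cong, auto simp: add.commute)
  qed
  finally show ?thesis
    unfolding sum_odd_quads_diff sum_odd_quads_sum sum_mixed_quads_eq by simp
qed

section \<open>A signed ternary form\<close>

text \<open>\<open>half_sign e\<close> is \<open>(-1)\<^bsup>e/2\<^esup>\<close> for even \<open>e\<close>; its value at odd \<open>e\<close> is junk.\<close>

definition half_sign :: "int \<Rightarrow> int" where
  "half_sign e = (if 4 dvd e then 1 else -1)"

text \<open>The triple stands for the form d X^2 + c X Y - e Y^2 of discriminant M. The even e will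
  be twice the cofactor of d in (M - c^2) / 8.\<close>

definition indef_forms :: "int \<Rightarrow> (int \<times> int \<times> int) set" where
  "indef_forms M = {(c, d, e). odd d \<and> 0 < d \<and> even e \<and> 0 < e \<and> c\<^sup>2 + 4 * d * e = M}"

text \<open>Coefficients after replacing X by X + Y in d X^2 + c X Y - e Y^2: y = c + 2 d and h = e
  - c - d. The condition e > 0 becomes d - h < y, and h may have any sign.\<close>

definition shifted_forms :: "int \<Rightarrow> (int \<times> int \<times> int) set" where
  "shifted_forms M = {(y, d, h). odd d \<and> 0 < d \<and> even h \<and> d - h < y \<and> y\<^sup>2 + 4 * d * h = M}"

lemma half_sign_add: "even a \<Longrightarrow> even b \<Longrightarrow> half_sign (a + b) = half_sign a * half_sign b"
  unfolding half_sign_def by (auto; presburger)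

lemma half_sign_uminus: "half_sign (- a) = half_sign a"
  by (simp add: half_sign_def)

lemma half_sign_odd_add:
  assumes "odd c" "odd d"
  shows "half_sign (c + d) = - (chi4 c * chi4 d)"
proof -
  have "c mod 4 = 1 \<or> c mod 4 = 3" "d mod 4 = 1 \<or> d mod 4 = 3"
    using assms by presburger+
  moreover have "4 dvd c + d \<longleftrightarrow> c mod 4 \<noteq> d mod 4"
    using assms by presburger
  ultimately show ?thesis
    by (auto simp: half_sign_def chi4_def)
qed

lemma chi4_add_even: "odd c \<Longrightarrow> even d \<Longrightarrow> chi4 (c + d) = half_sign d * chi4 c"
proof -
  assume "odd c" "even d"
  hence "c mod 4 = 1 \<or> c mod 4 = 3" "(c + d) mod 4 = (if 4 dvd d then c mod 4 else 4 - c mod 4)"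
    by presburger+
  thus ?thesis
    by (auto simp: half_sign_def chi4_def)
qed

lemma chi4_square: "odd c \<Longrightarrow> chi4 c * chi4 c = 1"
  using chi4_odd [of c] by auto

text \<open>Each factor on the left contributes -chi4 c, and these cancel. In the new variables the
  weight therefore does not involve d.\<close>

lemma shifted_weight:
  assumes "odd c" "odd d" "even e"
  shows "chi4 (c + 2 * d) * half_sign (e - c - d) = chi4 d * half_sign e"
proof -
  have "half_sign (2 * d) = -1"
    using assms(2) unfolding half_sign_def by presburger
  hence "chi4 (c + 2 * d) = - chi4 c"
    using chi4_add_even [of c "2 * d"] assms(1) by simp
  moreover have "half_sign (e + - (c + d)) = half_sign e * - (chi4 c * chi4 d)"
    using assms half_sign_odd_add [of c d] half_sign_uminus [of "c + d"] by (subst half_sign_add) auto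
  hence "half_sign (e - c - d) = - (half_sign e * (chi4 c * chi4 d))"
    by (simp add: algebra_simps)
  ultimately have "chi4 (c + 2 * d) * half_sign (e - c - d) = (chi4 c * chi4 c) * (chi4 d * half_sign e)"
    by simp
  thus ?thesis
    using chi4_square [OF assms(1)] by simp
qed

lemma finite_indef_forms: "finite (indef_forms M)"
proof (rule finite_subset)
  show "indef_forms M \<subseteq> {-M..M} \<times> {0..M} \<times> {0..M}"
  proof
    fix z assume "z \<in> indef_forms M"
    then obtain c d e where z: "z = (c, d, e)" "0 < d" "0 < e" "c\<^sup>2 + 4 * (d * e) = M"
      by (auto simp: indef_forms_def)
    have "d * 1 \<le> d * e" "1 * e \<le> d * e" "c\<^sup>2 \<ge> 0"
      using z by (auto intro!: mult_left_mono mult_right_mono)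
    hence "d \<le> M" "e \<le> M" "c\<^sup>2 \<le> M"
      using z by linarith+
    thus "z \<in> {-M..M} \<times> {0..M} \<times> {0..M}"
      using z square_le_imp [of c M] by auto
  qed
qed auto

lemma shifted_forms_eq_image:
  assumes "odd M"
  shows "shifted_forms M = (\<lambda>(c, d, e). (c + 2 * d, d, e - c - d)) ` indef_forms M"
proof (intro equalityI subsetI)
  fix z assume "z \<in> shifted_forms M"
  then obtain y d h where z: "z = (y, d, h)" "odd d" "0 < d" "even h" "d - h < y" "y\<^sup>2 + 4 * d * h = M"
    by (auto simp: shifted_forms_def)
  have "odd (y\<^sup>2 + 4 * d * h)"
    using z(6) assms by simp
  hence "odd y"
    by simp
  moreover have "(y - 2 * d)\<^sup>2 + 4 * d * (h + y - d) = M"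
    unfolding z(6) [symmetric] by (simp add: power2_eq_square algebra_simps)
  ultimately have "(y - 2 * d, d, h + y - d) \<in> indef_forms M"
    using z by (auto simp: indef_forms_def)
  thus "z \<in> (\<lambda>(c, d, e). (c + 2 * d, d, e - c - d)) ` indef_forms M"
    using z(1) by (intro image_eqI [of _ _ "(y - 2 * d, d, h + y - d)"]) auto
next
  fix z assume "z \<in> (\<lambda>(c, d, e). (c + 2 * d, d, e - c - d)) ` indef_forms M"
  then obtain c d e where z: "z = (c + 2 * d, d, e - c - d)" "odd d" "0 < d" "even e" "0 < e"
    "c\<^sup>2 + 4 * d * e = M"
    by (auto simp: indef_forms_def)
  have "odd (c\<^sup>2 + 4 * d * e)"
    using z(6) assms by simp
  hence "odd c"
    by simp
  moreover have "(c + 2 * d)\<^sup>2 + 4 * d * (e - c - d) = M"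
    unfolding z(6) [symmetric] by (simp add: power2_eq_square algebra_simps)
  ultimately show "z \<in> shifted_forms M"
    using z by (auto simp: shifted_forms_def)
qed

lemma finite_shifted_forms: "odd M \<Longrightarrow> finite (shifted_forms M)"
  by (simp add: shifted_forms_eq_image finite_indef_forms)

lemma sum_indef_forms_shift:
  assumes "odd M"
  shows "(\<Sum>(c, d, e) \<in> indef_forms M. chi4 d * half_sign e) =
         (\<Sum>(y, d, h) \<in> shifted_forms M. chi4 y * half_sign h)"
proof -
  have "inj_on (\<lambda>(c, d, e). (c + 2 * d, d, e - c - d)) (indef_forms M)"
    by (auto simp: inj_on_def)
  hence "(\<Sum>(y, d, h) \<in> shifted_forms M. chi4 y * half_sign h) =
         (\<Sum>(c, d, e) \<in> indef_forms M. chi4 (c + 2 * d) * half_sign (e - c - d))"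
    by (simp add: shifted_forms_eq_image [OF assms] sum.reindex case_prod_unfold)
  also have "\<dots> = (\<Sum>(c, d, e) \<in> indef_forms M. chi4 d * half_sign e)"
  proof (intro sum.cong refl, clarify)
    fix c d e assume "(c, d, e) \<in> indef_forms M"
    hence z: "odd d" "even e" "c\<^sup>2 + 4 * d * e = M"
      by (auto simp: indef_forms_def)
    have "odd (c\<^sup>2 + 4 * d * e)"
      using z(3) assms by simp
    hence "odd c"
      by simp
    with z show "chi4 (c + 2 * d) * half_sign (e - c - d) = chi4 d * half_sign e"
      by (simp add: shifted_weight)
  qed
  finally show ?thesis ..
qed

section \<open>Character sums over slices of fixed height\<close>

text \<open>A sum over a full period does not depend on its starting point, while the reflection y
  to -y moves the window to one starting at 1 - a - n and changes the sign.\<close>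

lemma sum_odd_periodic_eq_0:
  fixes f :: "int \<Rightarrow> int"
  assumes n: "n \<ge> 0" and per: "\<And>y. f (y + n) = f y" and odd: "\<And>y. f (- y) = - f y"
  shows "(\<Sum>y\<in>{a..<a + n}. f y) = 0"
proof -
  define F where "F = (\<lambda>a. \<Sum>y\<in>{a..<a + n}. f y)"
  have step: "F (a + 1) = F a" for a
  proof (cases "n = 0")
    case False
    hence "{a..<a + n} = insert a {a + 1..<a + n}" "{a + 1..<a + 1 + n} = insert (a + n) {a + 1..<a + n}"
      using n by auto
    thus ?thesis
      using per [of a] by (simp add: F_def)
  qed (simp add: F_def)
  have const: "F a = F 0" for a
  proof (induction a rule: int_induct [of _ 0])
    case (step2 i)
    thus ?case using step [of "i - 1"] by simp
  qed (simp_all add: step)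
  have "(\<Sum>y\<in>{a..<a + n}. f (- y)) = F (1 - a - n)"
    unfolding F_def by (rule sum.reindex_bij_witness [of _ uminus uminus]) auto
  hence "- F a = F (1 - a - n)"
    by (simp add: odd sum_negf F_def)
  hence "F a = 0"
    using const [of a] const [of "1 - a - n"] by simp
  thus ?thesis
    by (simp add: F_def)
qed

lemma sum_antisymmetric_eq_0:
  fixes f :: "'a \<Rightarrow> int"
  assumes "\<And>y. y \<in> A \<Longrightarrow> g y \<in> A" "\<And>y. y \<in> A \<Longrightarrow> g (g y) = y" "\<And>y. y \<in> A \<Longrightarrow> f (g y) = - f y"
  shows "sum f A = 0"
proof -
  have "sum f A = sum (\<lambda>y. f (g y)) A"
    by (rule sum.reindex_bij_witness [of _ g g]) (use assms in auto)
  also have "\<dots> = - sum f A"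
    using assms(3) by (simp add: sum_negf)
  finally show ?thesis
    by simp
qed

text \<open>What remains of \<open>shifted_forms\<close> on the slice |h| = k > 0, apart from the
  inequality: d is |g|, and the sign of g is the sign of h. As a condition on y it is even and has
  period 4k.\<close>

definition odd_quot :: "int \<Rightarrow> int \<Rightarrow> int \<Rightarrow> bool" where
  "odd_quot M k y \<longleftrightarrow> (\<exists>g. odd g \<and> M = y\<^sup>2 + 4 * k * g)"

lemma odd_quot_add:
  assumes "odd_quot M k y"
  shows "odd_quot M k (y + 4 * k)"
proof -
  obtain g where "odd g" "M = y\<^sup>2 + 4 * k * g"
    using assms by (auto simp: odd_quot_def)
  hence "odd (g - 2 * y - 4 * k)" "M = (y + 4 * k)\<^sup>2 + 4 * k * (g - 2 * y - 4 * k)"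
    by (auto simp: power2_eq_square algebra_simps)
  thus ?thesis
    unfolding odd_quot_def by blast
qed

lemma odd_quot_uminus: "odd_quot M k (- y) \<longleftrightarrow> odd_quot M k y"
  by (simp add: odd_quot_def)

lemma odd_quot_add_iff: "odd_quot M k (y + 4 * k) \<longleftrightarrow> odd_quot M k y"
proof
  assume "odd_quot M k (y + 4 * k)"
  hence "odd_quot M k (- (y + 4 * k))"
    by (simp only: odd_quot_uminus)
  from odd_quot_add [OF this] have "odd_quot M k (- y)"
    by simp
  thus "odd_quot M k y"
    by (simp only: odd_quot_uminus)
qed (rule odd_quot_add)

text \<open>y^2 < M means h = k, and d < y + k is then M < (y + 2k)^2 after multiplication by 4k.
  Otherwise h = -k, and d < y - k is (y - 2k)^2 < M.\<close>

lemma slice_image: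
  assumes k: "k > 0" "even k"
  shows "fst ` {(y, d, h) \<in> shifted_forms M. \<bar>h\<bar> = k} =
    {y. odd_quot M k y \<and> (if y\<^sup>2 < M then M < (y + 2 * k)\<^sup>2 else (y - 2 * k)\<^sup>2 < M)}" (is "?L = ?R")
proof (intro equalityI subsetI)
  fix y assume "y \<in> ?L"
  then obtain d h where z: "odd d" "0 < d" "d - h < y" "y\<^sup>2 + 4 * d * h = M" "\<bar>h\<bar> = k"
    by (auto simp: shifted_forms_def)
  consider "h = k" | "h = - k"
    using z(5) by linarith
  thus "y \<in> ?R"
  proof cases
    case 1
    have "4 * d * k > 0"
      using z(2) k by simp
    hence "y\<^sup>2 < M"
      using z(4) 1 by simp
    moreover have "4 * k * (y + k - d) > 0"
      using z(3) k 1 by simp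
    hence "M < (y + 2 * k)\<^sup>2"
      unfolding z(4) [symmetric] 1 by (simp add: power2_eq_square algebra_simps)
    moreover have "odd_quot M k y"
      unfolding odd_quot_def using z(1,4) 1 by (intro exI [of _ d]) auto
    ultimately show ?thesis
      by simp
  next
    case 2
    have "4 * d * k > 0"
      using z(2) k by simp
    hence "\<not> y\<^sup>2 < M"
      using z(4) 2 by simp
    moreover have "4 * k * (y - k - d) > 0"
      using z(3) k 2 by simp
    hence "(y - 2 * k)\<^sup>2 < M"
      unfolding z(4) [symmetric] 2 by (simp add: power2_eq_square algebra_simps)
    moreover have "odd_quot M k y"
      unfolding odd_quot_def using z(1,4) 2 by (intro exI [of _ "- d"]) auto
    ultimately show ?thesis
      by simp
  qed
next
  fix y assume "y \<in> ?R"
  then obtain g where g: "odd g" "M = y\<^sup>2 + 4 * k * g"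
    and if': "if y\<^sup>2 < M then M < (y + 2 * k)\<^sup>2 else (y - 2 * k)\<^sup>2 < M"
    by (auto simp: odd_quot_def)
  have "g \<noteq> 0"
    using g(1) by auto
  then consider "g > 0" | "g < 0"
    by linarith
  thus "y \<in> ?L"
  proof cases
    case 1
    hence "4 * k * g > 0"
      using k by simp
    hence "M < (y + 2 * k)\<^sup>2"
      using g(2) if' by simp
    hence "4 * k * (y + k - g) > 0"
      unfolding g(2) by (simp add: power2_eq_square algebra_simps)
    hence "g - k < y"
      using k by (simp add: zero_less_mult_iff)
    hence "(y, g, k) \<in> {(y, d, h) \<in> shifted_forms M. \<bar>h\<bar> = k}"
      using g 1 k by (auto simp: shifted_forms_def)
    thus ?thesis
      by force
  next
    case 2
    hence "4 * k * g < 0"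
      using k by (simp add: mult_pos_neg)
    hence "(y - 2 * k)\<^sup>2 < M"
      using g(2) if' by simp
    hence "4 * k * (y - k + g) > 0"
      unfolding g(2) by (simp add: power2_eq_square algebra_simps)
    hence "- g + k < y"
      using k by (simp add: zero_less_mult_iff)
    hence "(y, - g, - k) \<in> {(y, d, h) \<in> shifted_forms M. \<bar>h\<bar> = k}"
      using g 2 k by (auto simp: shifted_forms_def)
    thus ?thesis
      by force
  qed
qed

lemma slice_inj:
  assumes k: "k > 0"
  shows "inj_on fst {(y, d, h) \<in> shifted_forms M. \<bar>h\<bar> = k}"
proof (rule inj_onI)
  fix z z'
  assume zz: "z \<in> {(y, d, h) \<in> shifted_forms M. \<bar>h\<bar> = k}" "z' \<in> {(y, d, h) \<in> shifted_forms M. \<bar>h\<bar> = k}"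
    "fst z = fst z'"
  obtain y d h d' h' where z: "z = (y, d, h)" "z' = (y, d', h')"
    using zz(3) by (metis fst_conv surj_pair)
  have *: "0 < d" "0 < d'" "d * h = d' * h'" "\<bar>h\<bar> = \<bar>h'\<bar>" "h \<noteq> 0"
    using k zz(1,2) unfolding z by (auto simp: shifted_forms_def)
  have "\<bar>d\<bar> * \<bar>h\<bar> = \<bar>d'\<bar> * \<bar>h'\<bar>"
    using *(3) by (metis abs_mult)
  hence "d = d'"
    using * by auto
  thus "z = z'"
    using * z by simp
qed

text \<open>Here s is the integer square root of M. The admissible y, subject to
  \<open>odd_quot\<close>, fill a full period 4k if k <= s, up to one endpoint when M is a square;
  for k > s they fill two symmetric intervals. Oddness of \<open>chi4\<close> removes everything but
  the endpoint.\<close>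

lemma slice_sum:
  assumes M: "M = s\<^sup>2 \<or> (\<forall>z. z\<^sup>2 \<noteq> M)" and s: "0 \<le> s" "s\<^sup>2 \<le> M" "M < (s + 1)\<^sup>2"
    and k: "k > 0" "even k" and "odd M"
  shows "(\<Sum>(y, d, h) \<in> {(y, d, h) \<in> shifted_forms M. \<bar>h\<bar> = k}. chi4 y * half_sign h) =
    (if M = s\<^sup>2 \<and> k < s then - chi4 s * half_sign k else 0)"
proof -
  let ?S = "{(y, d, h) \<in> shifted_forms M. \<bar>h\<bar> = k}"
  let ?Y = "{y. odd_quot M k y \<and> (if y\<^sup>2 < M then M < (y + 2 * k)\<^sup>2 else (y - 2 * k)\<^sup>2 < M)}"
  have le: "z\<^sup>2 \<le> M \<longleftrightarrow> - s \<le> z \<and> z \<le> s" for z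
  proof
    assume "z\<^sup>2 \<le> M"
    hence "z\<^sup>2 < (s + 1)\<^sup>2"
      using s(3) by simp
    hence "\<bar>z\<bar> < \<bar>s + 1\<bar>"
      by (rule power2_less_imp_less [of "\<bar>z\<bar>" "\<bar>s + 1\<bar>", simplified]) 
    thus "- s \<le> z \<and> z \<le> s"
      using s(1) by linarith
  next
    assume "- s \<le> z \<and> z \<le> s"
    hence "z\<^sup>2 \<le> s\<^sup>2"
      by (intro abs_le_square_iff [THEN iffD1]) auto
    thus "z\<^sup>2 \<le> M"
      using s(2) by simp
  qed
  have eq: "z\<^sup>2 = M \<longleftrightarrow> M = s\<^sup>2 \<and> (z = s \<or> z = - s)" for z
    using M by (metis power2_eq_iff power2_minus)
  have lt: "z\<^sup>2 < M \<longleftrightarrow> - s \<le> z \<and> z \<le> s \<and> \<not> (M = s\<^sup>2 \<and> (z = s \<or> z = - s))" for z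
    using le [of z] eq [of z] by linarith
  have neq: "y\<^sup>2 \<noteq> M" if "odd_quot M k y" for y
    using that k unfolding odd_quot_def by auto
  have "(\<Sum>(y, d, h) \<in> ?S. chi4 y * half_sign h) = (\<Sum>z \<in> ?S. chi4 (fst z) * half_sign k)"
    by (intro sum.cong refl) (auto simp: abs_if half_sign_uminus split: if_splits)
  also have "\<dots> = (\<Sum>y \<in> fst ` ?S. chi4 y) * half_sign k"
    using slice_inj [OF k(1), of M] by (simp add: sum.reindex sum_distrib_right)
  also have "fst ` ?S = ?Y"
    using slice_image [OF k] by blast
  also have "sum chi4 ?Y = (if M = s\<^sup>2 \<and> k < s then - chi4 s else 0)"
  proof (cases "k \<le> s")
    case True
    \<comment> \<open>If M = s^2 then s is odd, so the even k cannot equal s.\<close>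
    have ks: "k < s" if "M = s\<^sup>2"
      using True that k \<open>odd M\<close> by (cases "k = s") auto
    let ?f = "\<lambda>y. if odd_quot M k y then chi4 y else 0"
    let ?I = "{s + 1 - 2 * k..<s + 1 - 2 * k + 4 * k}"
    \<comment> \<open>The values with y^2 < M run from s + 1 - 2k to s, the others from s + 1 to s +
      2k, in all 4k consecutive integers. For M = s^2 the last one fails the strict inequality (y -
      2k)^2 < M.\<close>
    have Y: "?Y = {y \<in> ?I. odd_quot M k y} - (if M = s\<^sup>2 then {s + 2 * k} else {})"
    proof (rule Set.set_eqI)
      fix y
      have "(if y\<^sup>2 < M then M < (y + 2 * k)\<^sup>2 else (y - 2 * k)\<^sup>2 < M) \<longleftrightarrow>
        y \<in> ?I \<and> y \<notin> (if M = s\<^sup>2 then {s + 2 * k} else {})" if "odd_quot M k y"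
      proof -
        have A: "M < (y + 2 * k)\<^sup>2 \<longleftrightarrow> \<not> (- s \<le> y + 2 * k \<and> y + 2 * k \<le> s)"
          using le [of "y + 2 * k"] by linarith
        have B: "y\<^sup>2 < M \<longleftrightarrow> - s \<le> y \<and> y \<le> s"
          using le [of y] neq [OF that] by linarith
        show ?thesis
          unfolding A B lt [of "y - 2 * k"] using True k(1) by auto
      qed
      thus "y \<in> ?Y \<longleftrightarrow> y \<in> {y \<in> ?I. odd_quot M k y} - (if M = s\<^sup>2 then {s + 2 * k} else {})"
        by auto
    qed
    have "(\<Sum>y\<in>?I. ?f y) = 0"
      using k by (intro sum_odd_periodic_eq_0)
        (auto simp: odd_quot_add_iff odd_quot_uminus chi4_uminus chi4_add_4)
    hence tot: "sum chi4 {y \<in> ?I. odd_quot M k y} = 0"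
      using sum.inter_filter [of ?I chi4 "odd_quot M k"] by (simp only: finite_atLeastLessThan_int)
    show ?thesis
    proof (cases "M = s\<^sup>2")
      case False
      with Y tot show ?thesis by simp
    next
      case sq: True
      have "odd s"
        using \<open>odd M\<close> sq by simp
      hence "odd (- s - k)"
        using k by simp
      moreover have "M = (s + 2 * k)\<^sup>2 + 4 * k * (- s - k)"
        unfolding sq by (simp add: power2_eq_square algebra_simps)
      ultimately have "odd_quot M k (s + 2 * k)"
        unfolding odd_quot_def by blast
      hence mem: "s + 2 * k \<in> {y \<in> ?I. odd_quot M k y}"
        using k(1) by simp
      have "sum chi4 ?Y = sum chi4 {y \<in> ?I. odd_quot M k y} - chi4 (s + 2 * k)"
        unfolding Y if_P [OF sq] using mem by (subst sum_diff1) (simp_all only: if_True finite_Collect_conjI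
          finite_atLeastLessThan_int Collect_mem_eq simp_thms)
      moreover obtain j where "k = 2 * j"
        using k(2) by (rule evenE)
      hence "chi4 (s + 2 * k) = chi4 s"
        using chi4_add_4 [of s j] by simp
      ultimately show ?thesis
        using tot sq ks by simp
    qed
  next
    case False
    \<comment> \<open>For k > s the ranges |y| <= s and |y - 2k| <= s are disjoint; they are
      preserved by y to -y and y to 4k - y.\<close>
    have Y: "?Y = {y. odd_quot M k y \<and> y\<^sup>2 < M} \<union> {y. odd_quot M k y \<and> (y - 2 * k)\<^sup>2 < M}"
    proof -
      have "(if y\<^sup>2 < M then M < (y + 2 * k)\<^sup>2 else (y - 2 * k)\<^sup>2 < M) \<longleftrightarrow>
        y\<^sup>2 < M \<or> (y - 2 * k)\<^sup>2 < M" for y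
      proof -
        have A: "M < (y + 2 * k)\<^sup>2 \<longleftrightarrow> \<not> (- s \<le> y + 2 * k \<and> y + 2 * k \<le> s)"
          using le [of "y + 2 * k"] by linarith
        show ?thesis
          unfolding A lt using False by auto
      qed
      thus ?thesis
        by auto
    qed
    have fin: "finite {y. odd_quot M k y \<and> y\<^sup>2 < M}" "finite {y. odd_quot M k y \<and> (y - 2 * k)\<^sup>2 < M}"
      unfolding lt by (rule finite_subset [of _ "{-s..s}"], auto, rule finite_subset [of _ "{2*k-s..2*k+s}"], auto)
    have "sum chi4 ?Y = sum chi4 {y. odd_quot M k y \<and> y\<^sup>2 < M} + sum chi4 {y. odd_quot M k y \<and> (y - 2 * k)\<^sup>2 < M}"
      unfolding Y using False fin by (intro sum.union_disjoint) (auto simp: lt)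
    also have "sum chi4 {y. odd_quot M k y \<and> y\<^sup>2 < M} = 0"
      by (rule sum_antisymmetric_eq_0 [where g = uminus]) (auto simp: odd_quot_uminus chi4_uminus)
    also have "sum chi4 {y. odd_quot M k y \<and> (y - 2 * k)\<^sup>2 < M} = 0"
    proof (rule sum_antisymmetric_eq_0 [where g = "\<lambda>y. - y + 4 * k"])
      fix y assume y: "y \<in> {y. odd_quot M k y \<and> (y - 2 * k)\<^sup>2 < M}"
      have "- y + 4 * k - 2 * k = - (y - 2 * k)"
        by simp
      hence "(- y + 4 * k - 2 * k)\<^sup>2 = (y - 2 * k)\<^sup>2"
        by (metis power2_minus)
      thus "- y + 4 * k \<in> {y. odd_quot M k y \<and> (y - 2 * k)\<^sup>2 < M}"
        using y by (simp only: mem_Collect_eq odd_quot_add_iff odd_quot_uminus)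
      show "chi4 (- y + 4 * k) = - chi4 y"
        by (simp only: chi4_add_4 chi4_uminus)
    qed auto
    finally show ?thesis
      using False by simp
  qed
  finally show ?thesis
    by simp
qed

text \<open>At h = 0 the conditions force M = s^2, y = s and d < s, which leaves (s - 1) / 2 odd
  values of d, each of weight \<open>chi4 s\<close>.\<close>

lemma slice_zero_sum:
  assumes M: "M = s\<^sup>2 \<or> (\<forall>z. z\<^sup>2 \<noteq> M)" and s: "0 \<le> s" and "odd M"
  shows "2 * (\<Sum>(y, d, h) \<in> {(y, d, h) \<in> shifted_forms M. \<bar>h\<bar> = 0}. chi4 y * half_sign h) =
    (if M = s\<^sup>2 then chi4 s * (s - 1) else 0)"
proof (cases "M = s\<^sup>2")
  case False
  hence "{(y, d, h) \<in> shifted_forms M. \<bar>h\<bar> = 0} = {}"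
    using M by (auto simp: shifted_forms_def)
  with False show ?thesis
    by (simp only: sum.empty) simp
next
  case True
  have "odd s"
    using \<open>odd M\<close> True by simp
  then obtain j where j: "s = 2 * j + 1"
    by (rule oddE)
  have "{(y, d, h) \<in> shifted_forms M. \<bar>h\<bar> = 0} = (\<lambda>i. (s, 2 * i + 1, 0)) ` {0..<j}"
  proof (intro equalityI subsetI)
    fix z assume "z \<in> {(y, d, h) \<in> shifted_forms M. \<bar>h\<bar> = 0}"
    then obtain y d where z: "z = (y, d, 0)" "odd d" "0 < d" "d < y" "y\<^sup>2 = s\<^sup>2"
      using True by (auto simp: shifted_forms_def)
    have "y = s"
      using z(3-5) s by (auto simp: power2_eq_iff)
    moreover obtain i where "d = 2 * i + 1"
      using z(2) by (rule oddE)
    ultimately show "z \<in> (\<lambda>i. (s, 2 * i + 1, 0)) ` {0..<j}"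
      using z j by auto
  qed (use True j in \<open>auto simp: shifted_forms_def\<close>)
  moreover have "inj_on (\<lambda>i. (s, 2 * i + 1, 0::int)) {0..<j}"
    by (auto simp: inj_on_def)
  ultimately have "(\<Sum>(y, d, h) \<in> {(y, d, h) \<in> shifted_forms M. \<bar>h\<bar> = 0}. chi4 y * half_sign h) = j * chi4 s"
    using s j by (simp add: sum.reindex half_sign_def)
  thus ?thesis
    using True j by (simp add: algebra_simps)
qed

lemma sum_half_sign:
  assumes "odd s" "s > 0"
  shows "(\<Sum>k | even k \<and> 0 < k \<and> k < s. half_sign k) = (if s mod 4 = 1 then 0 else -1)"
proof -
  obtain j where j: "s = 2 * j + 1"
    using assms(1) by (rule oddE)
  hence "j \<ge> 0"
    using assms(2) by simp
  then obtain m where m: "j = int m"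
    by (metis nonneg_int_cases)
  have "{k. even k \<and> 0 < k \<and> k < s} = (\<lambda>i. 2 * int i) ` {1..m}"
  proof (intro equalityI subsetI)
    fix k assume "k \<in> {k. even k \<and> 0 < k \<and> k < s}"
    then obtain i where "k = 2 * i" "0 < i" "i \<le> int m"
      using j m by (auto elim!: evenE)
    thus "k \<in> (\<lambda>i. 2 * int i) ` {1..m}"
      by (intro image_eqI [of _ _ "nat i"]) auto
  qed (use j m in auto)
  moreover have "inj_on (\<lambda>i. 2 * int i) {1..m}"
    by (auto simp: inj_on_def)
  ultimately have "(\<Sum>k | even k \<and> 0 < k \<and> k < s. half_sign k) = (\<Sum>i\<in>{1..m}. half_sign (2 * int i))"
    by (simp add: sum.reindex)
  also have "\<dots> = (if even m then 0 else -1)"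
  proof (induction m)
    case (Suc m)
    have "half_sign (2 * int (Suc m)) = (if even m then -1 else 1)"
      unfolding half_sign_def by presburger
    with Suc show ?case
      by (simp add: sum.atLeast1_atMost_eq)
  qed simp
  also have "even m \<longleftrightarrow> s mod 4 = 1"
    using j m by presburger
  finally show ?thesis .
qed

text \<open>For M = s^2 the slice h = 0 gives chi4 s (s - 1), and the boundary terms of the even
  heights k < s give 0 if s = 1 modulo 4 and -2 if s = 3 modulo 4. Both cases combine to chi4 s s -
  1.\<close>

lemma sum_indef_forms:
  assumes M: "M = s\<^sup>2 \<or> (\<forall>z. z\<^sup>2 \<noteq> M)" and s: "0 \<le> s" "s\<^sup>2 \<le> M" "M < (s + 1)\<^sup>2" and "odd M"
  shows "2 * (\<Sum>(c, d, e) \<in> indef_forms M. chi4 d * half_sign e) =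
    (if M = s\<^sup>2 then chi4 s * s - 1 else 0)"
proof -
  let ?V = "shifted_forms M"
  let ?w = "\<lambda>(y, d, h). chi4 y * half_sign h"
  let ?ht = "\<lambda>(y, d, h). \<bar>h\<bar>"
  let ?E = "{k. even k \<and> 0 < k \<and> k < s}"
  have finE: "finite ?E"
    by (rule finite_subset [of _ "{0..s}"]) auto
  \<comment> \<open>Including all even k < s, even when the slice is empty, lets the boundary terms
    be summed over exactly these k.\<close>
  define T where "T = (?ht ` ?V \<union> ?E) - {0}"
  have finV: "finite ?V"
    using finite_shifted_forms \<open>odd M\<close> by blast
  hence finT: "finite T"
    using finE by (simp add: T_def)
  have T: "k > 0 \<and> even k" if "k \<in> T" for k
    using that unfolding T_def shifted_forms_def by auto
  have slice: "{z. z \<in> ?V \<and> ?ht z = k} = {(y, d, h) \<in> ?V. \<bar>h\<bar> = k}" for k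
    by auto
  have "?ht ` ?V \<subseteq> insert 0 T"
    unfolding T_def by blast
  hence "sum ?w ?V = (\<Sum>k\<in>insert 0 T. sum ?w {z. z \<in> ?V \<and> ?ht z = k})"
    using sum.group [OF finV, of "insert 0 T" ?ht ?w] finT by simp
  also have "\<dots> = sum ?w {(y, d, h) \<in> ?V. \<bar>h\<bar> = 0} + (\<Sum>k\<in>T. sum ?w {(y, d, h) \<in> ?V. \<bar>h\<bar> = k})"
    using finT unfolding slice by (subst sum.insert) (auto simp: T_def)
  also have "(\<Sum>k\<in>T. sum ?w {(y, d, h) \<in> ?V. \<bar>h\<bar> = k}) =
      (\<Sum>k\<in>T. if M = s\<^sup>2 \<and> k < s then - chi4 s * half_sign k else 0)"
    using T by (intro sum.cong refl slice_sum [OF M s]) (auto simp: \<open>odd M\<close>)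
  also have "\<dots> = (if M = s\<^sup>2 then - chi4 s * sum half_sign ?E else 0)"
  proof -
    have "{k \<in> T. k < s} = ?E"
      unfolding T_def by (auto simp: shifted_forms_def)
    moreover have "(\<Sum>k\<in>T. if k < s then - chi4 s * half_sign k else 0) =
        (\<Sum>k\<in>{k \<in> T. k < s}. - chi4 s * half_sign k)"
      using sum.inter_filter [OF finT, of "\<lambda>k. - chi4 s * half_sign k" "\<lambda>k. k < s"] by simp
    ultimately show ?thesis
      by (simp add: sum_distrib_left)
  qed
  finally have main: "2 * (\<Sum>(c, d, e) \<in> indef_forms M. chi4 d * half_sign e) =
      (if M = s\<^sup>2 then chi4 s * (s - 1) - 2 * chi4 s * sum half_sign ?E else 0)"
    using slice_zero_sum [OF M s(1) \<open>odd M\<close>] sum_indef_forms_shift [OF \<open>odd M\<close>] by simp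
  show ?thesis
  proof (cases "M = s\<^sup>2")
    case True
    hence "odd s"
      using \<open>odd M\<close> by simp
    moreover from this have "s > 0"
      using s(1) by (cases "s = 0") auto
    ultimately show ?thesis
      using main True sum_half_sign [of s] by (auto simp: chi4_def algebra_simps, presburger+)
  qed (use main in simp)
qed

section \<open>The signed sum over c^2 + 8 u^2 + 8 v^2\<close>

definition ternary :: "int \<Rightarrow> (int \<times> int \<times> int) set" where
  "ternary M = {(c, u, v). c\<^sup>2 + 8 * u\<^sup>2 + 8 * v\<^sup>2 = M}"

definition parity_sign :: "int \<Rightarrow> int" where
  "parity_sign k = (if even k then 1 else -1)"

text \<open>For fixed c, u + v has the parity of q = (M - c^2) / 8, so the two-square theorem gives
  a sum over \<open>indef_forms\<close>. If M = s^2, the terms with q = 0 give 2 and the rest gives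
  2 (chi4 s s - 1); here chi4 s s is the root congruent to 1 modulo 4.\<close>

lemma sum_ternary_sign:
  assumes "odd M" "M > 0"
  shows "(\<Sum>(c, u, v) \<in> ternary M. parity_sign (u + v)) = 2 * (\<Sum>r | 4 dvd r - 1 \<and> r\<^sup>2 = M. r)"
proof -
  obtain s where s: "0 \<le> s" "s\<^sup>2 \<le> M" "M < (s + 1)\<^sup>2"
    using int_sqrt_exists [of M] assms by auto
  have M: "M = s\<^sup>2 \<or> (\<forall>z. z\<^sup>2 \<noteq> M)"
  proof (rule ccontr)
    assume "\<not> ?thesis"
    then obtain z where z: "z\<^sup>2 = M" "z\<^sup>2 \<noteq> s\<^sup>2"
      by auto
    hence "s\<^sup>2 < \<bar>z\<bar>\<^sup>2" "\<bar>z\<bar>\<^sup>2 < (s + 1)\<^sup>2"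
      using s by auto
    hence "s < \<bar>z\<bar>" "\<bar>z\<bar> < s + 1"
      using s(1) power2_less_imp_less by (metis abs_ge_zero, metis add_nonneg_nonneg zero_le_one power2_less_imp_less)
    thus False
      by simp
  qed
  define q where "q = (\<lambda>c. (M - c\<^sup>2) div 8)"
  define C where "C = {c. c\<^sup>2 \<le> M \<and> 8 dvd M - c\<^sup>2}"
  have q: "M = c\<^sup>2 + 8 * q c" "q c \<ge> 0" if "c \<in> C" for c
    using that by (auto simp: C_def q_def)
  have finC: "finite C"
    unfolding C_def by (rule finite_subset [of _ "{-M..M}"]) (auto dest: square_le_imp)
  have tern: "ternary M = (SIGMA c:C. reps 1 (q c))"
  proof (intro equalityI subsetI)
    fix z assume "z \<in> ternary M"
    then obtain c u v where z: "z = (c, u, v)" "M = c\<^sup>2 + 8 * (u\<^sup>2 + v\<^sup>2)"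
      by (auto simp: ternary_def)
    thus "z \<in> (SIGMA c:C. reps 1 (q c))"
      by (auto simp: C_def q_def reps_def)
  next
    fix z assume "z \<in> (SIGMA c:C. reps 1 (q c))"
    then obtain c u v where z: "z = (c, u, v)" "c \<in> C" "u\<^sup>2 + v\<^sup>2 = q c"
      by (auto simp: reps_def)
    thus "z \<in> ternary M"
      using q(1) [OF z(2)] by (simp add: ternary_def)
  qed
  have par: "parity_sign (u + v) = parity_sign (u\<^sup>2 + v\<^sup>2)" for u v
    by (simp add: parity_sign_def)
  have "(\<Sum>(c, u, v) \<in> ternary M. parity_sign (u + v)) = (\<Sum>c\<in>C. \<Sum>(u, v)\<in>reps 1 (q c). parity_sign (u + v))"
    unfolding tern using finC finite_reps [of 1] by (subst sum.Sigma) auto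
  also have "\<dots> = (\<Sum>c\<in>C. int (card (reps 1 (q c))) * parity_sign (q c))"
  proof (rule sum.cong [OF refl])
    fix c
    have "(\<Sum>(u, v)\<in>reps 1 (q c). parity_sign (u + v)) = (\<Sum>z\<in>reps 1 (q c). parity_sign (q c))"
    proof (rule sum.cong [OF refl])
      fix z assume "z \<in> reps 1 (q c)"
      then obtain u v where "z = (u, v)" "u\<^sup>2 + v\<^sup>2 = q c"
        by (auto simp: reps_def)
      with par [of u v] show "(case z of (u, v) \<Rightarrow> parity_sign (u + v)) = parity_sign (q c)"
        by simp
    qed
    thus "(\<Sum>(u, v)\<in>reps 1 (q c). parity_sign (u + v)) = int (card (reps 1 (q c))) * parity_sign (q c)"
      by simp
  qed
  also have "\<dots> = (\<Sum>c\<in>C. (if q c = 0 then 1 else 0) +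
      4 * (\<Sum>d\<in>{d. 0 < d \<and> d dvd q c \<and> odd d \<and> q c \<noteq> 0}. chi4 d * half_sign (2 * (q c div d))))"
  proof (rule sum.cong [OF refl])
    fix c assume c: "c \<in> C"
    show "int (card (reps 1 (q c))) * parity_sign (q c) = (if q c = 0 then 1 else 0) +
      4 * (\<Sum>d\<in>{d. 0 < d \<and> d dvd q c \<and> odd d \<and> q c \<noteq> 0}. chi4 d * half_sign (2 * (q c div d)))"
    proof (cases "q c = 0")
      case True
      have "reps 1 0 = {(0, 0)}"
        by (auto simp: reps_def sum_power2_eq_zero_iff)
      with True show ?thesis
        by (simp add: parity_sign_def)
    next
      case False
      hence q0: "q c > 0"
        using q(2) [OF c] by simp
      have "divsum chi4 (q c) = (\<Sum>d\<in>{d. 0 < d \<and> d dvd q c \<and> odd d \<and> q c \<noteq> 0}. chi4 d)"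
        unfolding divsum_def using finite_pos_divisors [OF q0] False
        by (intro sum.mono_neutral_right) (auto simp: chi4_even)
      \<comment> \<open>As d is odd, the cofactor e has the parity of \<open>q c\<close>, and 4
        divides 2 e exactly when e is even.\<close>
      moreover have "half_sign (2 * (q c div d)) = parity_sign (q c)" if d: "d dvd q c" "odd d" for d
      proof -
        obtain e where e: "q c = d * e"
          using d(1) by (auto elim: dvdE)
        have "d \<noteq> 0"
          using d(2) by auto
        hence "q c div d = e"
          using e by simp
        moreover have "even (q c) \<longleftrightarrow> even e"
          using e d(2) by simp
        ultimately show ?thesis
          unfolding half_sign_def parity_sign_def by auto
      qed
      ultimately show ?thesis
        using card_reps_1 [OF q0] False by (simp add: sum_distrib_right)
    qed
  qed
  also have "\<dots> = (\<Sum>c\<in>C. if q c = 0 then 1 else 0) +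
      4 * (\<Sum>c\<in>C. \<Sum>d\<in>{d. 0 < d \<and> d dvd q c \<and> odd d \<and> q c \<noteq> 0}. chi4 d * half_sign (2 * (q c div d)))"
    by (simp add: sum.distrib sum_distrib_left)
  also have "(\<Sum>c\<in>C. \<Sum>d\<in>{d. 0 < d \<and> d dvd q c \<and> odd d \<and> q c \<noteq> 0}. chi4 d * half_sign (2 * (q c div d))) =
      (\<Sum>(c, d, e) \<in> indef_forms M. chi4 d * half_sign e)"
  proof -
    let ?D = "\<lambda>c. {d. 0 < d \<and> d dvd q c \<and> odd d \<and> q c \<noteq> 0}"
    let ?g = "\<lambda>(c, d). (c, d, 2 * (q c div d))"
    have finD: "finite (?D c)" if "c \<in> C" for c
    proof (cases "q c = 0")
      case False
      hence "q c > 0"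
        using q(2) [OF that] by simp
      from finite_pos_divisors [OF this] show ?thesis
        by (rule finite_subset [rotated]) auto
    qed auto
    have "indef_forms M = ?g ` (SIGMA c:C. ?D c)"
    proof (intro equalityI subsetI)
      fix z assume "z \<in> indef_forms M"
      then obtain c d e where z: "z = (c, d, 2 * e)" "odd d" "0 < d" "0 < e" "c\<^sup>2 + 8 * (d * e) = M"
        by (auto simp: indef_forms_def elim!: evenE)
      have "d * e > 0"
        using z by simp
      hence "c \<in> C" "q c = d * e"
        using z by (auto simp: C_def q_def)
      thus "z \<in> ?g ` (SIGMA c:C. ?D c)"
        using z by (intro image_eqI [of _ _ "(c, d)"]) auto
    next
      fix z assume "z \<in> ?g ` (SIGMA c:C. ?D c)"
      then obtain c d where z: "z = (c, d, 2 * (q c div d))" "c \<in> C" "0 < d" "d dvd q c" "odd d" "q c \<noteq> 0"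
        by auto
      from z(4) obtain e where e: "q c = d * e"
        by (auto elim: dvdE)
      have "q c > 0"
        using q(2) [OF z(2)] z(6) by simp
      hence "e > 0"
        using e z(3) by (simp add: zero_less_mult_iff)
      moreover have "q c div d = e"
        using e z(3) by simp
      ultimately show "z \<in> indef_forms M"
        using z q(1) [OF z(2)] e by (simp add: indef_forms_def)
    qed
    moreover have "inj_on ?g (SIGMA c:C. ?D c)"
      by (auto simp: inj_on_def)
    ultimately have "(\<Sum>(c, d, e) \<in> indef_forms M. chi4 d * half_sign e) =
        (\<Sum>(c, d) \<in> (SIGMA c:C. ?D c). chi4 d * half_sign (2 * (q c div d)))"
      by (simp add: sum.reindex case_prod_unfold)
    thus ?thesis
      using finC finD by (subst sum.Sigma) auto
  qed
  also have "(\<Sum>c\<in>C. if q c = 0 then 1 else 0 :: int) = int (card {c. c\<^sup>2 = M})"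
  proof -
    have "{c \<in> C. q c = 0} = {c. c\<^sup>2 = M}"
      using q(1) by (auto simp: C_def q_def)
    thus ?thesis
      using finC by (simp add: sum.inter_filter [symmetric])
  qed
  also have "int (card {c. c\<^sup>2 = M}) + 4 * (\<Sum>(c, d, e) \<in> indef_forms M. chi4 d * half_sign e)
      = 2 * (\<Sum>r | 4 dvd r - 1 \<and> r\<^sup>2 = M. r)"
  proof (cases "M = s\<^sup>2")
    case True
    have "odd s"
      using True assms(1) by simp
    hence "s \<noteq> 0"
      by auto
    have "{c. c\<^sup>2 = M} = {s, - s}"
      using True by (auto simp: power2_eq_iff)
    hence "card {c. c\<^sup>2 = M} = 2"
      using \<open>s \<noteq> 0\<close> by simp
    moreover have "{r. 4 dvd r - 1 \<and> r\<^sup>2 = M} = {chi4 s * s}"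
    proof -
      have "s mod 4 = 1 \<or> s mod 4 = 3"
        using \<open>odd s\<close> by presburger
      thus ?thesis
        unfolding True power2_eq_iff chi4_def by (auto; presburger)
    qed
    ultimately show ?thesis
      using sum_indef_forms [OF M s assms(1)] True by simp
  next
    case False
    hence "{c. c\<^sup>2 = M} = {}" "{r. 4 dvd r - 1 \<and> r\<^sup>2 = M} = {}"
      using M by auto
    thus ?thesis
      using sum_indef_forms [OF M s assms(1)] False by simp
  qed
  finally show ?thesis .
qed

section \<open>Reduction of the triangular sum\<close>

definition quaternary :: "int \<Rightarrow> (int \<times> int \<times> int \<times> int) set" where
  "quaternary m = {(c, e, f, w). c\<^sup>2 + 2 * e\<^sup>2 + 4 * f\<^sup>2 + 4 * w\<^sup>2 = m}"

text \<open>The parity of w is left open: odd w gives the triangular count, and arbitrary w serves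
  to count all of \<open>quaternary\<close>.\<close>

definition odd_forms :: "int \<Rightarrow> (int \<times> int \<times> int \<times> int) set" where
  "odd_forms m = {(x, y, z, w). odd x \<and> odd y \<and> odd z \<and> x\<^sup>2 + y\<^sup>2 + 2 * z\<^sup>2 + 16 * w\<^sup>2 = 4 * m}"

lemma finite_quaternary: "finite (quaternary m)"
proof (rule finite_subset)
  show "quaternary m \<subseteq> {-m..m} \<times> {-m..m} \<times> {-m..m} \<times> {-m..m}"
  proof
    fix z assume "z \<in> quaternary m"
    then obtain c e f w where z: "z = (c, e, f, w)" "c\<^sup>2 + 2 * e\<^sup>2 + 4 * f\<^sup>2 + 4 * w\<^sup>2 = m"
      by (auto simp: quaternary_def)
    have "c\<^sup>2 \<ge> 0" "e\<^sup>2 \<ge> 0" "f\<^sup>2 \<ge> 0" "w\<^sup>2 \<ge> 0"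
      by auto
    hence "c\<^sup>2 \<le> m" "e\<^sup>2 \<le> m" "f\<^sup>2 \<le> m" "w\<^sup>2 \<le> m"
      using z(2) by linarith+
    thus "z \<in> {-m..m} \<times> {-m..m} \<times> {-m..m} \<times> {-m..m}"
      using z(1) by (auto dest: square_le_imp)
  qed
qed auto

lemma odd_square_mod_8: "odd (x::int) \<Longrightarrow> \<exists>k. x\<^sup>2 = 8 * k + 1"
proof -
  assume "odd x"
  then obtain i where i: "x = 2 * i + 1"
    by (rule oddE)
  have "even (i * (i + 1))"
    by simp
  then obtain k where "i * (i + 1) = 2 * k"
    by (rule evenE)
  hence "x\<^sup>2 = 8 * k + 1"
    unfolding i by (simp add: power2_eq_square algebra_simps)
  thus ?thesis ..
qed

lemma sign_cong_mod_4:
  assumes "odd x" "odd (y::int)"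
  shows "\<exists>s\<in>{1, -1}. 4 dvd x - s * y"
proof (cases "4 dvd x - y")
  case False
  hence "4 dvd x + y"
    using assms by presburger
  thus ?thesis
    by (intro bexI [of _ "-1"]) auto
qed auto

text \<open>The signs \<open>s\<close> and \<open>t\<close> are forced by the congruences
  \<open>x \<equiv> s y\<close> and \<open>(x + s y) / 2 \<equiv> t z\<close> modulo 4.\<close>

lemma card_odd_forms:
  assumes "odd m"
  shows "card {(x, y, z, w) \<in> odd_forms m. P w} = 4 * card {(c, e, f, w) \<in> quaternary m. P w}"
proof -
  let ?A = "{(c, e, f, w) \<in> quaternary m. P w}"
  let ?g = "\<lambda>((c, e, f, w), s, t). (c + 2 * f + 2 * e, s * (c + 2 * f - 2 * e), t * (c - 2 * f), w)"
  let ?S = "?A \<times> {1, -1::int} \<times> {1, -1::int}"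
  have oddc: "odd c" if "(c, e, f, w) \<in> quaternary m" for c e f w
  proof -
    have "odd (c\<^sup>2 + 2 * e\<^sup>2 + 4 * f\<^sup>2 + 4 * w\<^sup>2)"
      using that assms by (simp add: quaternary_def)
    thus ?thesis by simp
  qed
  have eq: "(c + 2 * f + 2 * e)\<^sup>2 + (s * (c + 2 * f - 2 * e))\<^sup>2 + 2 * (t * (c - 2 * f))\<^sup>2 + 16 * w\<^sup>2 =
    4 * (c\<^sup>2 + 2 * e\<^sup>2 + 4 * f\<^sup>2 + 4 * w\<^sup>2)" if "s \<in> {1, -1}" "t \<in> {1, -1}" for c e f w s t :: int
    using that by (auto simp: power2_eq_square algebra_simps)
  have inj: "inj_on ?g ?S"
  proof (rule inj_onI)
    fix p p' assume p: "p \<in> ?S" "p' \<in> ?S" "?g p = ?g p'"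
    obtain c e f w s t where 1: "p = ((c, e, f, w), s, t)"
      by (metis surj_pair)
    obtain c' e' f' w' s' t' where 2: "p' = ((c', e', f', w'), s', t')"
      by (metis surj_pair)
    have "odd c" "odd c'"
      using p oddc unfolding 1 2 by auto
    moreover have "s = 1 \<or> s = -1" "t = 1 \<or> t = -1" "s' = 1 \<or> s' = -1" "t' = 1 \<or> t' = -1"
      using p unfolding 1 2 by auto
    moreover have g: "c + 2 * f + 2 * e = c' + 2 * f' + 2 * e'" "s * (c + 2 * f - 2 * e) = s' * (c' + 2 * f' - 2 * e')"
      "t * (c - 2 * f) = t' * (c' - 2 * f')" "w = w'"
      using p(3) unfolding 1 2 by auto
    ultimately have s: "s = s'"
      by (elim disjE) (simp_all, presburger+)
    hence "c + 2 * f - 2 * e = c' + 2 * f' - 2 * e'"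
      using g(2) \<open>s = 1 \<or> s = -1\<close> by auto
    hence e: "e = e'" and cf: "c + 2 * f = c' + 2 * f'"
      using g(1) by linarith+
    have t: "t = t'"
      using \<open>odd c\<close> \<open>odd c'\<close> \<open>t = 1 \<or> t = -1\<close> \<open>t' = 1 \<or> t' = -1\<close> g(3) cf
      by (elim disjE) (simp_all, presburger+)
    hence "c - 2 * f = c' - 2 * f'"
      using g(3) \<open>t = 1 \<or> t = -1\<close> by auto
    with cf have "c = c'" "f = f'"
      by linarith+
    with s t e g(4) show "p = p'"
      by (simp add: 1 2)
  qed
  have "?g ` ?S = {(x, y, z, w) \<in> odd_forms m. P w}"
  proof (intro equalityI subsetI)
    fix q assume "q \<in> ?g ` ?S"
    then obtain p where p: "p \<in> ?S" "q = ?g p"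
      by (metis (no_types, lifting) imageE)
    obtain c e f w s t where pp: "p = ((c, e, f, w), s, t)"
      by (metis surj_pair)
    have q: "q = (c + 2 * f + 2 * e, s * (c + 2 * f - 2 * e), t * (c - 2 * f), w)"
      "(c, e, f, w) \<in> quaternary m" "P w" "s \<in> {1, -1}" "t \<in> {1, -1}"
      using p unfolding pp by auto
    show "q \<in> {(x, y, z, w) \<in> odd_forms m. P w}"
      using q(2-5) oddc [OF q(2)] eq [OF q(4,5), of c f e w]
      unfolding q(1) odd_forms_def quaternary_def by auto
  next
    fix q assume "q \<in> {(x, y, z, w) \<in> odd_forms m. P w}"
    then obtain x y z w where q: "q = (x, y, z, w)" "odd x" "odd y" "odd z" "P w"
      "x\<^sup>2 + y\<^sup>2 + 2 * z\<^sup>2 + 16 * w\<^sup>2 = 4 * m"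
      by (auto simp: odd_forms_def)
    obtain s where s: "s \<in> {1, -1}" "4 dvd x - s * y"
      using sign_cong_mod_4 [OF q(2,3)] by blast
    then obtain e where e: "x - s * y = 4 * e"
      by (auto elim: dvdE)
    have ss: "s * s = 1"
      using s by auto
    \<comment> \<open>Thus u = (x + s y) / 2 and x - s y = 4 e; the same rotation is then applied to
      u and t z, giving c = (u + t z) / 2.\<close>
    define u where "u = x - 2 * e"
    have u: "odd u"
      using q(2) by (simp add: u_def)
    obtain t where t: "t \<in> {1, -1}" "4 dvd u - t * z"
      using sign_cong_mod_4 [OF u q(4)] by blast
    then obtain f where f: "u - t * z = 4 * f"
      by (auto elim: dvdE)
    have tt: "t * t = 1"
      using t by auto
    define c where "c = u - 2 * f"
    have x: "x = c + 2 * f + 2 * e"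
      by (simp add: c_def u_def)
    have "s * y = c + 2 * f - 2 * e"
      using e by (simp add: c_def u_def)
    hence y: "y = s * (c + 2 * f - 2 * e)"
      using ss by (metis mult.assoc mult_1)
    have "t * z = c - 2 * f"
      using f by (simp add: c_def)
    hence z: "z = t * (c - 2 * f)"
      using tt by (metis mult.assoc mult_1)
    have "4 * (c\<^sup>2 + 2 * e\<^sup>2 + 4 * f\<^sup>2 + 4 * w\<^sup>2) = 4 * m"
      using q(6) eq [OF s(1) t(1), of c f e w] unfolding x y z by linarith
    hence "((c, e, f, w), s, t) \<in> ?S"
      using q(5) s(1) t(1) by (auto simp: quaternary_def)
    moreover have "q = ?g ((c, e, f, w), s, t)"
      unfolding q(1) x y z by simp
    ultimately show "q \<in> ?g ` ?S"
      by blast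
  qed
  with card_image [OF inj] have "card {(x, y, z, w) \<in> odd_forms m. P w} = card ?S"
    by (simp only:)
  thus ?thesis
    by (simp add: card_cartesian_product)
qed

text \<open>Multiplying by 8 and adding 1 + 1 + 2 + 16 = 20 completes all squares at once, and 8n +
  20 = 4 (2n + 5).\<close>

lemma t_eq_card_odd_forms:
  "t 1 1 2 16 n = card {(x, y, z, w) \<in> odd_forms (int (2 * n + 5)). odd w}"
proof -
  let ?T = "{(x :: int, y :: int, z :: int, w :: int).
     int n = int 1 * (x * (x - 1) div 2) + int 1 * (y * (y - 1) div 2)
           + int 2 * (z * (z - 1) div 2) + int 16 * (w * (w - 1) div 2)}"
  let ?g = "\<lambda>(x, y, z, w). (2 * x - 1, 2 * y - 1, 2 * z - 1, 2 * w - 1 :: int)"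
  have tri: "(2 * x - 1)\<^sup>2 = 8 * (x * (x - 1) div 2) + 1" for x :: int
  proof -
    have "even (x * (x - 1))"
      by simp
    then obtain k where k: "x * (x - 1) = 2 * k"
      by (rule evenE)
    have "(2 * x - 1)\<^sup>2 = 4 * (x * (x - 1)) + 1"
      by (simp add: power2_eq_square algebra_simps)
    thus ?thesis
      by (simp add: k)
  qed
  have iff: "(x, y, z, w) \<in> ?T \<longleftrightarrow> ?g (x, y, z, w) \<in> {(x, y, z, w) \<in> odd_forms (int (2 * n + 5)). odd w}"
    for x y z w
  proof -
    have "(int n = int 1 * a + int 1 * b + int 2 * c + int 16 * d) \<longleftrightarrow>
      (8 * a + 1 + (8 * b + 1) + 2 * (8 * c + 1) + 16 * (8 * d + 1) = 4 * int (2 * n + 5))" for a b c d :: int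
      by simp linarith
    moreover have "odd (2 * x - 1)" for x :: int
      by simp
    ultimately show ?thesis
      unfolding odd_forms_def mem_Collect_eq prod.case tri by blast
  qed
  have "{(x, y, z, w) \<in> odd_forms (int (2 * n + 5)). odd w} = ?g ` ?T"
  proof (intro equalityI subsetI)
    fix q assume q: "q \<in> {(x, y, z, w) \<in> odd_forms (int (2 * n + 5)). odd w}"
    then obtain x y z w where xyzw: "q = (x, y, z, w)" "odd x" "odd y" "odd z" "odd w"
      by (auto simp: odd_forms_def)
    have half: "\<exists>i. x = 2 * i - 1" if "odd x" for x :: int
      using that by presburger
    obtain x' y' z' w' where "x = 2 * x' - 1" "y = 2 * y' - 1" "z = 2 * z' - 1" "w = 2 * w' - 1"
      using half [OF xyzw(2)] half [OF xyzw(3)] half [OF xyzw(4)] half [OF xyzw(5)] by blast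
    hence q': "q = ?g (x', y', z', w')"
      using xyzw(1) by simp
    hence "(x', y', z', w') \<in> ?T"
      using q by (simp only: iff)
    thus "q \<in> ?g ` ?T"
      unfolding q' by (rule imageI)
  next
    fix q assume "q \<in> ?g ` ?T"
    then obtain p where p: "p \<in> ?T" "q = ?g p"
      by (rule imageE)
    obtain x y z w where "p = (x, y, z, w)"
      by (metis surj_pair)
    with p iff show "q \<in> {(x, y, z, w) \<in> odd_forms (int (2 * n + 5)). odd w}"
      by (simp only:)
  qed
  moreover have "inj_on ?g ?T"
    by (auto simp: inj_on_def)
  ultimately show ?thesis
    unfolding t_def by (simp only: card_image)
qed

text \<open>By the symmetry of f and w, twice the count sums [f odd] + [w odd]. This is 1 if the
  parities differ and 1 - (-1)^f if they agree.\<close>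

lemma card_quaternary_odd:
  "2 * int (card {(c, e, f, w) \<in> quaternary m. odd w}) =
   int (card (quaternary m)) - (\<Sum>(c, e, f, w) \<in> {(c, e, f, w) \<in> quaternary m. even (f + w)}. parity_sign f)"
proof -
  let ?Q = "quaternary m"
  have filter: "(\<Sum>(c, e, f, w) \<in> {(c, e, f, w) \<in> ?Q. P f w}. h f) =
      (\<Sum>(c, e, f, w) \<in> ?Q. if P f w then h f else 0)" for P and h :: "int \<Rightarrow> int"
  proof -
    have "{(c, e, f, w) \<in> ?Q. P f w} = {z \<in> ?Q. case z of (c, e, f, w) \<Rightarrow> P f w}"
      by auto
    thus ?thesis
      using finite_quaternary [of m] by (simp add: sum.inter_filter) (intro sum.cong, auto)
  qed
  have card: "int (card {(c, e, f, w) \<in> ?Q. P f w}) = (\<Sum>(c, e, f, w) \<in> ?Q. if P f w then 1 else 0)" for P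
    using filter [where P = P and h = "\<lambda>_. 1"] by (simp add: case_prod_unfold)
  have swap: "(\<Sum>(c, e, f, w) \<in> ?Q. if odd w then 1 else 0 :: int) = (\<Sum>(c, e, f, w) \<in> ?Q. if odd f then 1 else 0)"
    by (rule sum.reindex_bij_witness [of _ "\<lambda>(c, e, f, w). (c, e, w, f)" "\<lambda>(c, e, f, w). (c, e, w, f)"])
       (auto simp: quaternary_def)
  have "2 * int (card {(c, e, f, w) \<in> ?Q. odd w}) =
      (\<Sum>(c, e, f, w) \<in> ?Q. if odd w then 1 else 0) + (\<Sum>(c, e, f, w) \<in> ?Q. if odd f then 1 else 0)"
    using card [of "\<lambda>f w. odd w"] swap by simp
  also have "\<dots> = (\<Sum>(c, e, f, w) \<in> ?Q. 1 - (if even (f + w) then parity_sign f else 0))"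
    unfolding sum.distrib [symmetric] by (intro sum.cong refl) (auto simp: parity_sign_def)
  also have "\<dots> = int (card ?Q) - (\<Sum>(c, e, f, w) \<in> ?Q. if even (f + w) then parity_sign f else 0)"
    by (simp add: case_prod_unfold sum_subtractf)
  finally show ?thesis
    by (simp only: filter [where P = "\<lambda>f w. even (f + w)" and h = parity_sign])
qed

text \<open>The substitution f = u + v, w = u - v turns 4 f^2 + 4 w^2 into 8 u^2 + 8 v^2. For each e
  the ternary sum then picks out r with r^2 = m - 2 e^2.\<close>

lemma sum_quaternary_sign:
  assumes "odd m"
  shows "(\<Sum>(c, e, f, w) \<in> {(c, e, f, w) \<in> quaternary m. even (f + w)}. parity_sign f) =
   2 * (\<Sum>(r, s) \<in> {(r, s). 4 dvd r - 1 \<and> m = r\<^sup>2 + 2 * s\<^sup>2}. r)"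
proof -
  \<comment> \<open>The interval is only a finite bound for e; values with 2 e^2 > m contribute
    nothing on either side.\<close>
  let ?T = "SIGMA e:{-m..m}. ternary (m - 2 * e\<^sup>2)"
  let ?g = "\<lambda>(e, c, u, v). (c, e, u + v, u - v)"
  have fint: "finite (ternary M)" for M
  proof (rule finite_subset)
    show "ternary M \<subseteq> {-M..M} \<times> {-M..M} \<times> {-M..M}"
    proof
      fix z assume "z \<in> ternary M"
      then obtain c u v where z: "z = (c, u, v)" "c\<^sup>2 + 8 * u\<^sup>2 + 8 * v\<^sup>2 = M"
        by (auto simp: ternary_def)
      have "c\<^sup>2 \<ge> 0" "u\<^sup>2 \<ge> 0" "v\<^sup>2 \<ge> 0"
        by auto
      hence "c\<^sup>2 \<le> M" "u\<^sup>2 \<le> M" "v\<^sup>2 \<le> M"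
        using z(2) by linarith+
      thus "z \<in> {-M..M} \<times> {-M..M} \<times> {-M..M}"
        using z(1) by (auto dest: square_le_imp)
    qed
  qed auto
  have "{(c, e, f, w) \<in> quaternary m. even (f + w)} = ?g ` ?T"
  proof (intro equalityI subsetI)
    fix z assume "z \<in> {(c, e, f, w) \<in> quaternary m. even (f + w)}"
    then obtain c e f w where z: "z = (c, e, f, w)" "even (f + w)" "c\<^sup>2 + 2 * e\<^sup>2 + 4 * f\<^sup>2 + 4 * w\<^sup>2 = m"
      by (auto simp: quaternary_def)
    obtain u where "f + w = 2 * u"
      using z(2) by (rule evenE)
    hence w: "w = u - (f - u)"
      by simp
    have "c\<^sup>2 \<ge> 0" "e\<^sup>2 \<ge> 0" "f\<^sup>2 \<ge> 0" "w\<^sup>2 \<ge> 0"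
      by auto
    hence "e\<^sup>2 \<le> m"
      using z(3) by linarith
    hence "e \<in> {-m..m}"
      using square_le_imp [of e m] by simp
    moreover have "(c, u, f - u) \<in> ternary (m - 2 * e\<^sup>2)"
      unfolding z(3) [symmetric] w by (simp add: ternary_def power2_eq_square algebra_simps)
    ultimately show "z \<in> ?g ` ?T"
      using w z(1) by (intro image_eqI [of _ _ "(e, c, u, f - u)"]) auto
  next
    fix z assume "z \<in> ?g ` ?T"
    then obtain e c u v where z: "z = (c, e, u + v, u - v)" "c\<^sup>2 + 8 * u\<^sup>2 + 8 * v\<^sup>2 = m - 2 * e\<^sup>2"
      by (auto simp: ternary_def)
    hence "m = c\<^sup>2 + 2 * e\<^sup>2 + 4 * (u + v)\<^sup>2 + 4 * (u - v)\<^sup>2"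
      by (simp add: power2_eq_square algebra_simps)
    thus "z \<in> {(c, e, f, w) \<in> quaternary m. even (f + w)}"
      unfolding z(1) by (simp add: quaternary_def)
  qed
  moreover have "inj_on ?g ?T"
    by (auto simp: inj_on_def)
  ultimately have "(\<Sum>(c, e, f, w) \<in> {(c, e, f, w) \<in> quaternary m. even (f + w)}. parity_sign f) =
      (\<Sum>(e, c, u, v) \<in> ?T. parity_sign (u + v))"
    by (simp add: sum.reindex case_prod_unfold)
  also have "\<dots> = (\<Sum>e\<in>{-m..m}. \<Sum>(c, u, v) \<in> ternary (m - 2 * e\<^sup>2). parity_sign (u + v))"
    using fint by (subst sum.Sigma) auto
  also have "\<dots> = (\<Sum>e\<in>{-m..m}. 2 * (\<Sum>r | 4 dvd r - 1 \<and> r\<^sup>2 = m - 2 * e\<^sup>2. r))"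
  proof (rule sum.cong [OF refl])
    fix e
    have odd: "odd (m - 2 * e\<^sup>2)"
      using assms by simp
    show "(\<Sum>(c, u, v) \<in> ternary (m - 2 * e\<^sup>2). parity_sign (u + v)) =
      2 * (\<Sum>r | 4 dvd r - 1 \<and> r\<^sup>2 = m - 2 * e\<^sup>2. r)"
    proof (cases "m - 2 * e\<^sup>2 > 0")
      case True
      with odd show ?thesis by (rule sum_ternary_sign)
    next
      case False
      moreover have "m - 2 * e\<^sup>2 \<noteq> 0"
        using odd by (metis even_zero)
      ultimately have neg: "m - 2 * e\<^sup>2 < 0"
        by simp
      have "ternary (m - 2 * e\<^sup>2) = {}"
      proof (rule ccontr)
        assume "ternary (m - 2 * e\<^sup>2) \<noteq> {}"
        then obtain c u v where "c\<^sup>2 + 8 * u\<^sup>2 + 8 * v\<^sup>2 = m - 2 * e\<^sup>2"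
          by (auto simp: ternary_def)
        moreover have "c\<^sup>2 \<ge> 0" "u\<^sup>2 \<ge> 0" "v\<^sup>2 \<ge> 0"
          by auto
        ultimately show False
          using neg by linarith
      qed
      moreover have "{r. 4 dvd r - 1 \<and> r\<^sup>2 = m - 2 * e\<^sup>2} = {}"
        using neg by (metis (mono_tags, lifting) Collect_empty_eq not_less zero_le_power2)
      ultimately show ?thesis
        by (simp only: sum.empty mult_zero_right)
    qed
  qed
  also have "\<dots> = 2 * (\<Sum>(s, r) \<in> (SIGMA e:{-m..m}. {r. 4 dvd r - 1 \<and> r\<^sup>2 = m - 2 * e\<^sup>2}). r)"
  proof -
    have "finite {r. 4 dvd r - 1 \<and> r\<^sup>2 = m - 2 * e\<^sup>2}" for e
      by (rule finite_subset [of _ "{- (m - 2 * e\<^sup>2)..m - 2 * e\<^sup>2}"]) (auto dest!: eq_refl square_le_imp)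
    thus ?thesis
      unfolding sum_distrib_left [symmetric] by (subst sum.Sigma) auto
  qed
  also have "(\<Sum>(s, r) \<in> (SIGMA e:{-m..m}. {r. 4 dvd r - 1 \<and> r\<^sup>2 = m - 2 * e\<^sup>2}). r) =
      (\<Sum>(r, s) \<in> {(r, s). 4 dvd r - 1 \<and> m = r\<^sup>2 + 2 * s\<^sup>2}. r)"
  proof (rule sum.reindex_bij_witness [of _ "\<lambda>(r, s). (s, r)" "\<lambda>(s, r). (r, s)"])
    fix z assume "z \<in> {(r, s). 4 dvd r - 1 \<and> m = r\<^sup>2 + 2 * s\<^sup>2}"
    then obtain r s where z: "z = (r, s)" "4 dvd r - 1" "m = r\<^sup>2 + 2 * s\<^sup>2"
      by auto
    have "r\<^sup>2 \<ge> 0" "s\<^sup>2 \<ge> 0"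
      by auto
    hence "s\<^sup>2 \<le> m"
      using z(3) by linarith
    thus "(case z of (r, s) \<Rightarrow> (s, r)) \<in> (SIGMA e:{-m..m}. {r. 4 dvd r - 1 \<and> r\<^sup>2 = m - 2 * e\<^sup>2})"
      using z square_le_imp [of s m] by auto
  qed auto
  finally show ?thesis .
qed

section \<open>The unsigned count as a convolution\<close>

lemma divsum_convolution:
  "(\<Sum>N | odd N \<and> 0 < N \<and> N < 4 * k. divsum f N * divsum g (4 * k - N)) =
   (\<Sum>(a, x, b, y) \<in> odd_quads k. f x * g y)"
proof -
  let ?N = "{N. odd N \<and> 0 < N \<and> N < 4 * k}"
  let ?D = "\<lambda>N. {d::int. 0 < d \<and> d dvd N}"
  let ?S = "SIGMA N:?N. ?D N \<times> ?D (4 * k - N)"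
  let ?g = "\<lambda>(N, x, y). (N div x, x, (4 * k - N) div y, y)"
  have finN: "finite ?N"
    by (rule finite_subset [of _ "{0..4 * k}"]) auto
  have finD: "finite (?D N \<times> ?D (4 * k - N))" if "N \<in> ?N" for N
    using that by (auto intro!: finite_pos_divisors)
  have "odd_quads k = ?g ` ?S"
  proof (intro equalityI subsetI)
    fix z assume "z \<in> odd_quads k"
    then obtain a x b y where z: "z = (a, x, b, y)" "odd a" "odd x" "odd b" "odd y"
      "0 < a" "0 < x" "0 < b" "0 < y" "a * x + b * y = 4 * k"
      by (auto simp: odd_quads_def)
    have pos: "0 < a * x" "0 < b * y"
      using z by auto
    have eq: "4 * k - a * x = b * y" and less: "a * x < 4 * k"
      using z(10) pos by linarith+
    have "(a * x, x, y) \<in> ?S"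
      using z pos less by (simp add: eq)
    moreover have "z = ?g (a * x, x, y)"
      using z by (simp add: eq)
    ultimately show "z \<in> ?g ` ?S"
      by blast
  next
    fix z assume "z \<in> ?g ` ?S"
    then obtain N x y where z: "z = (N div x, x, (4 * k - N) div y, y)" "odd N" "0 < N" "N < 4 * k"
      "0 < x" "x dvd N" "0 < y" "y dvd 4 * k - N"
      by auto
    obtain a where a: "N = x * a"
      using z(6) by (auto elim: dvdE)
    obtain b where b: "4 * k - N = y * b"
      using z(8) by (auto elim: dvdE)
    have "odd (4 * k - N)"
      using z(2) by simp
    hence "odd y" "odd b"
      unfolding b by auto
    moreover have "odd x" "odd a"
      using z(2) unfolding a by auto
    moreover have "0 < x * a" "0 < y * b"
      using z(3,4) a b by linarith+
    hence "0 < a" "0 < b"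
      using z(5,7) by (simp_all add: zero_less_mult_iff)
    moreover have "N div x = a" "(4 * k - N) div y = b"
      using z(5,7) unfolding b unfolding a by simp_all
    moreover have "a * x + b * y = 4 * k"
      using a b by (simp add: mult.commute)
    ultimately show "z \<in> odd_quads k"
      using z by (simp add: odd_quads_def)
  qed
  moreover have "inj_on ?g ?S"
    by (auto simp: inj_on_def)
  ultimately have "(\<Sum>(a, x, b, y) \<in> odd_quads k. f x * g y) = (\<Sum>(N, x, y) \<in> ?S. f x * g y)"
    by (simp add: sum.reindex case_prod_unfold)
  also have "\<dots> = (\<Sum>N\<in>?N. \<Sum>(x, y) \<in> ?D N \<times> ?D (4 * k - N). f x * g y)"
    using finN finD by (subst sum.Sigma) auto
  also have "\<dots> = (\<Sum>N\<in>?N. divsum f N * divsum g (4 * k - N))"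
    by (simp add: divsum_def sum_product sum.cartesian_product)
  finally show ?thesis ..
qed

text \<open>\<open>G\<close> splits 4m into an odd N = a^2 + b^2 and 4m - N = z^2 + 2 v^2. Its part
  with a odd corresponds to \<open>odd_forms\<close>, hence to four copies of
  \<open>quaternary\<close>, and exchanging a and b doubles this. The representation numbers bring
  the same factor 8 = 4 * 2, which cancels.\<close>

lemma card_quaternary:
  assumes "odd m" "m > 0"
  shows "int (card (quaternary m)) = 2 * (\<Sum>d | 0 < d \<and> d dvd m. (m div d) * chi8 d)"
proof -
  let ?N = "{N. odd N \<and> 0 < N \<and> N < 4 * m}"
  define G where "G = (SIGMA N:?N. reps 1 N \<times> reps 2 (4 * m - N))"
  have finN: "finite ?N"
    by (rule finite_subset [of _ "{0..4 * m}"]) auto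
  have finR: "finite (reps 1 N \<times> reps 2 (4 * m - N))" for N
    by (auto intro!: finite_reps)
  have finG: "finite G"
    unfolding G_def using finN finR by auto
  have G: "(N, (a, b), (z, v)) \<in> G \<longleftrightarrow> odd z \<and> N = a\<^sup>2 + b\<^sup>2 \<and> a\<^sup>2 + b\<^sup>2 + z\<^sup>2 + 2 * v\<^sup>2 = 4 * m" for N a b z v
  proof
    assume "(N, (a, b), (z, v)) \<in> G"
    hence *: "odd N" "a\<^sup>2 + b\<^sup>2 = N" "z\<^sup>2 + 2 * v\<^sup>2 = 4 * m - N"
      by (auto simp: G_def reps_def)
    have "odd (z\<^sup>2 + 2 * v\<^sup>2)"
      unfolding *(3) using *(1) by simp
    hence "odd z"
      by simp
    with * show "odd z \<and> N = a\<^sup>2 + b\<^sup>2 \<and> a\<^sup>2 + b\<^sup>2 + z\<^sup>2 + 2 * v\<^sup>2 = 4 * m"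
      by simp
  next
    assume *: "odd z \<and> N = a\<^sup>2 + b\<^sup>2 \<and> a\<^sup>2 + b\<^sup>2 + z\<^sup>2 + 2 * v\<^sup>2 = 4 * m"
    hence eq: "z\<^sup>2 + 2 * v\<^sup>2 = 4 * m - N"
      by simp
    have "odd (z\<^sup>2 + 2 * v\<^sup>2)"
      using * by simp
    hence "odd (4 * m - N)"
      unfolding eq .
    hence "odd N"
      by simp
    have "N \<ge> 0" "v\<^sup>2 \<ge> 0" "z\<^sup>2 > 0"
      using * by auto
    moreover have "N \<noteq> 0"
      using \<open>odd N\<close> by auto
    ultimately have "0 < N" "N < 4 * m"
      using eq by linarith+
    with * \<open>odd N\<close> show "(N, (a, b), (z, v)) \<in> G"
      by (simp add: G_def reps_def)
  qed
  let ?O = "{(x, y, z, w) \<in> odd_forms m. True}"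
  let ?G1 = "{(N, (a, b), (z, v)) \<in> G. odd a}"
  let ?G2 = "{(N, (a, b), (z, v)) \<in> G. even a}"
  have "bij_betw (\<lambda>(x, y, z, w). (x\<^sup>2 + (4 * w)\<^sup>2, (x, 4 * w), (y, z))) ?O ?G1"
  proof (rule bij_betwI')
    fix p q assume "p \<in> ?O" "q \<in> ?O"
    thus "((case p of (x, y, z, w) \<Rightarrow> (x\<^sup>2 + (4 * w)\<^sup>2, (x, 4 * w), (y, z))) =
      (case q of (x, y, z, w) \<Rightarrow> (x\<^sup>2 + (4 * w)\<^sup>2, (x, 4 * w), (y, z)))) = (p = q)"
      by (cases p; cases q) auto
  next
    fix p assume "p \<in> ?O"
    thus "(case p of (x, y, z, w) \<Rightarrow> (x\<^sup>2 + (4 * w)\<^sup>2, (x, 4 * w), (y, z))) \<in> ?G1"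
      by (auto simp: odd_forms_def G power_mult_distrib)
  next
    fix q assume "q \<in> ?G1"
    then obtain N a b z v where q: "q = (N, (a, b), (z, v))" "odd a" "odd z" "N = a\<^sup>2 + b\<^sup>2"
      "a\<^sup>2 + b\<^sup>2 + z\<^sup>2 + 2 * v\<^sup>2 = 4 * m"
      using G by auto
    obtain i where i: "a\<^sup>2 = 8 * i + 1"
      using odd_square_mod_8 [OF q(2)] by blast
    obtain j where j: "z\<^sup>2 = 8 * j + 1"
      using odd_square_mod_8 [OF q(3)] by blast
    \<comment> \<open>Odd squares are 1 modulo 8, which in turn forces b even, then v odd, and
      finally b / 2 even because m is odd.\<close>
    have "b\<^sup>2 = 2 * (2 * m - v\<^sup>2 - 4 * i - 4 * j - 1)"
      using q(5) i j by simp
    hence "even (b\<^sup>2)"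
      by simp
    then obtain b' where b': "b = 2 * b'"
      by (auto elim: evenE)
    have v2: "v\<^sup>2 = 2 * (m - b'\<^sup>2 - 2 * i - 2 * j - 1) + 1"
      using q(5) i j unfolding b' by (simp add: power_mult_distrib)
    hence "odd (v\<^sup>2)"
      by simp
    hence "odd v"
      by simp
    then obtain l where l: "v\<^sup>2 = 8 * l + 1"
      using odd_square_mod_8 by blast
    have "b'\<^sup>2 = m - 1 - 2 * i - 2 * j - 4 * l"
      using v2 l by simp
    hence "even (b'\<^sup>2)"
      using assms(1) by simp
    then obtain w where w: "b = 4 * w"
      using b' by (auto elim!: evenE)
    have "(a, z, v, w) \<in> ?O"
      using q \<open>odd v\<close> unfolding w by (simp add: odd_forms_def power_mult_distrib)
    moreover have "q = (case (a, z, v, w) of (x, y, z, w) \<Rightarrow> (x\<^sup>2 + (4 * w)\<^sup>2, (x, 4 * w), (y, z)))"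
      using q w by simp
    ultimately show "\<exists>p\<in>?O. q = (case p of (x, y, z, w) \<Rightarrow> (x\<^sup>2 + (4 * w)\<^sup>2, (x, 4 * w), (y, z)))"
      by blast
  qed
  hence card1: "card ?G1 = 4 * card (quaternary m)"
    using card_odd_forms [OF assms(1), of "\<lambda>_. True"] bij_betw_same_card by fastforce
  have parity: "odd a \<longleftrightarrow> even b" if "(N, (a, b), (z, v)) \<in> G" for N a b z v
  proof -
    have "odd N" "N = a\<^sup>2 + b\<^sup>2"
      using that by (auto simp: G_def reps_def)
    hence "odd (a\<^sup>2 + b\<^sup>2)"
      by simp
    thus ?thesis
      by auto
  qed
  have "bij_betw (\<lambda>(N, (a, b), (z, v)). (N, (b, a), (z, v))) ?G1 ?G2"
    by (rule bij_betw_byWitness [where f' = "\<lambda>(N, (a, b), (z, v)). (N, (b, a), (z, v))"])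
       (use parity in \<open>auto simp: G add.commute\<close>)
  hence card2: "card ?G2 = card ?G1"
    by (simp add: bij_betw_same_card)
  have "finite ?G1" "finite ?G2"
    by (rule finite_subset [OF _ finG], blast)+
  hence "card (?G1 \<union> ?G2) = card ?G1 + card ?G2"
    by (rule card_Un_disjoint) auto
  moreover have "?G1 \<union> ?G2 = G"
    by auto
  ultimately have "card G = card ?G1 + card ?G2"
    by (simp only:)
  hence "int (card G) = 8 * int (card (quaternary m))"
    using card1 card2 by simp
  moreover have "int (card G) = (\<Sum>N\<in>?N. int (card (reps 1 N)) * int (card (reps 2 (4 * m - N))))"
    unfolding G_def using finN finR by (simp add: card_SigmaI card_cartesian_product)
  moreover have "\<dots> = 8 * (\<Sum>N\<in>?N. divsum chi4 N * divsum (\<lambda>d. chi4 d * chi8 d) (4 * m - N))"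
    unfolding sum_distrib_left
    by (intro sum.cong refl) (simp add: card_reps_1 card_reps_2_odd)
  moreover have "(\<Sum>N\<in>?N. divsum chi4 N * divsum (\<lambda>d. chi4 d * chi8 d) (4 * m - N)) =
      2 * (\<Sum>d | 0 < d \<and> d dvd m. (m div d) * chi8 d)"
    using divsum_convolution [where k = m and f = chi4 and g = "\<lambda>d. chi4 d * chi8 d"] sum_odd_quads_chi [OF assms] by simp
  ultimately show ?thesis
    by simp
qed

lemma sum_nat_divisors_kronecker:
  fixes m :: nat
  assumes "odd m"
  shows "(\<Sum>d | d dvd m. int (m div d) * kronecker 2 (int d)) =
    (\<Sum>d | 0 < d \<and> d dvd int m. (int m div d) * chi8 d)"
proof (rule sum.reindex_bij_witness [of _ nat int])
  have m: "m > 0"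
    using assms by (cases m) auto
  fix d assume "d \<in> {d. d dvd m}"
  hence "odd d" "d > 0"
    using assms m dvd_pos_nat by auto
  thus "(int m div int d) * chi8 (int d) = int (m div d) * kronecker 2 (int d)"
    by (simp add: kronecker_2_eq_chi8 zdiv_int)
  show "int d \<in> {d. 0 < d \<and> d dvd int m}"
    using \<open>d \<in> {d. d dvd m}\<close> \<open>d > 0\<close> by simp
qed (auto simp: nat_dvd_iff)

theorem theorem3p2:
  fixes n :: nat
  assumes "n > 0"
  shows "int (t 1 1 2 16 n) =
    4 * (\<Sum>d | d dvd 2 * n + 5. int ((2 * n + 5) div d) * kronecker 2 (int d))
    - 4 * (\<Sum>(r, s) \<in> {(r :: int, s :: int). 4 dvd r - 1 \<and> int (2 * n + 5) = r\<^sup>2 + 2 * s\<^sup>2}. r)"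
proof -
  define m where "m = int (2 * n + 5)"
  have m: "odd m" "m > 0"
    by (simp_all add: m_def)
  have "int (t 1 1 2 16 n) = 4 * int (card {(c, e, f, w) \<in> quaternary m. odd w})"
    unfolding t_eq_card_odd_forms m_def [symmetric] using card_odd_forms [OF m(1), of odd] by simp
  also have "\<dots> = 2 * (int (card (quaternary m)) -
      (\<Sum>(c, e, f, w) \<in> {(c, e, f, w) \<in> quaternary m. even (f + w)}. parity_sign f))"
    using card_quaternary_odd [of m] by simp
  \<comment> \<open>Both the full count and the signed correction carry a factor 2, which gives the
    coefficients 4.\<close>
  also have "\<dots> = 4 * (\<Sum>d | 0 < d \<and> d dvd m. (m div d) * chi8 d)
      - 4 * (\<Sum>(r, s) \<in> {(r, s). 4 dvd r - 1 \<and> m = r\<^sup>2 + 2 * s\<^sup>2}. r)"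
    unfolding card_quaternary [OF m] sum_quaternary_sign [OF m(1)] by simp
  also have "(\<Sum>d | 0 < d \<and> d dvd m. (m div d) * chi8 d) =
      (\<Sum>d | d dvd 2 * n + 5. int ((2 * n + 5) div d) * kronecker 2 (int d))"
    using sum_nat_divisors_kronecker [of "2 * n + 5"] by (simp only: m_def) simp
  finally show ?thesis
    by (simp only: m_def)
qed

end
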